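(* Let $m\ge 1$ be an integer, $p$ a prime, and $S$ a matrix as in the context with $s_{0,1}s_{1,2}\cdots s_{m-1,m}\neq 0$. Let $\mathcal F=\{F_0,\ldots,F_m\}\in\mathfrak F(S,m)$ be a polynomial system over $\mathbb F_p$ of total degree $d\ge 2$, and let $\mathbf w_n=(u_{n,0},\ldots,u_{n,m})$, $n\ge 0$, be the sequence generated by iterating $\mathcal F$ from an initial vector $\mathbf w_0\in\mathbb F_p^{m+1}$. Assume that $\{\mathbf w_n\}$ is purely periodic with (least) period $\tau$. Then for any fixed integer $\nu\ge1$ and any positive integer $N\le\tau$, the discrepancy of the sequence $$\left(\frac{u_{n,0}}p,\ldots,\frac{u_{n,m-1}}p\right),\qquad n=0,\ldots,N-1,$$ satisfies the bound $O\big(p^{\alpha_{m,\nu}}N^{-\beta_{m,\nu}}(\log p)^m\big)$, where $$\alpha_{m,\nu}=\frac{m^2+m\nu+m}{2\nu(m+\nu)}\qquad\text{and}\qquad\beta_{m,\nu}=\frac1{2\nu},$$ and the implied constant depends only on $d$, $m$ and $\nu$.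
   Context: The discrepancy of a sequence $\Gamma$ of $N$ points in $[0,1)^s$ is $$\Delta(\Gamma)=\sup_{B\subseteq[0,1)^s}\left|\frac{T_\Gamma(B)}N-|B|\right|,$$ where the supremum is over all boxes $B=[\alpha_1,\beta_1)\times\cdots\times[\alpha_s,\beta_s)\subseteq[0,1)^s$, $|B|$ is the volume of $B$, and $T_\Gamma(B)$ is the number of points of $\Gamma$ (counted with multiplicity) inside $B$. $\mathbb F_p$ is represented by $\{0,1,\ldots,p-1\}$. $S$ is an integral upper triangular $(m+1)\times(m+1)$ matrix, rows and columns indexed by $0,\ldots,m$, with ones on the diagonal and entries $s_{i,j}$ for $0\le i<j\le m$ (used as exponents, hence non-negative). $\mathfrak F(S,m)$ is the set of all systems $\{F_0,\ldots,F_m\}$ of polynomials in $\mathbb F_p[X_0,\ldots,X_m]$ of the form $$F_i=X_iG_i(X_{i+1},\ldots,X_m)+H_i(X_{i+1},\ldots,X_m)\quad (0\le i\le m-1),\qquad F_m=g_mX_m+h_m,$$ with $g_m,h_m\in\mathbb F_p$, $g_m\ne0$, $G_i,H_i\in\mathbb F_p[X_{i+1},\ldots,X_m]$, where for $0\le i\le m-1$ $$G_i=g_iX_{i+1}^{s_{i,i+1}}\cdots X_m^{s_{i,m}}+\widetilde G_i,\qquad g_i\in\mathbb F_p^*,$$ and $\deg_{X_j}\widetilde G_i<s_{i,j}$, $\deg_{X_j}H_i\le s_{i,j}$ for $j=i+1,\ldots,m$ (the zero polynomial has degree $-\infty$). The sequence generated by iterating $\mathcal F$: $u_{n+1,i}\equiv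 F_i(u_{n,0},\ldots,u_{n,m})\pmod p$ with $0\le u_{n,i}<p$, for $i=0,\ldots,m$, $n\ge0$. Purely periodic with period $\tau$ means $\mathbf w_{n+\tau}=\mathbf w_n$ for all $n\ge0$, with $\tau$ the least such positive integer. *)

theory Defs
  imports
    Complex_Main
    "HOL-Library.Poly_Mapping"
    "HOL-Library.FuncSet"
    "HOL-Library.Extended_Real"
    "HOL-Computational_Algebra.Primes"
    "HOL-Number_Theory.Cong"
    "Jordan_Normal_Form.Matrix"
begin

text \<open>
  The prime \<open>p\<close> has to be quantified inside the main statement (the implied constant is uniform
  in it), so \<open>\<bbbF>\<^sub>p\<close> is not a type. Its elements are the integers \<open>0, \<dots>, p - 1\<close>, and a polynomial
  over \<open>\<bbbF>\<^sub>p\<close> is the integer polynomial whose coefficients are these representatives. Hence its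
  support and its degrees are those over \<open>\<bbbF>\<^sub>p\<close>, while ring identities over \<open>\<bbbF>\<^sub>p\<close> are
  coefficientwise congruences modulo \<open>p\<close>.
\<close>

type_synonym mpoly = "(nat \<Rightarrow>\<^sub>0 nat) \<Rightarrow>\<^sub>0 int"

definition mConst :: "int \<Rightarrow> mpoly" where
  "mConst c = Poly_Mapping.single 0 c"

definition mVar :: "nat \<Rightarrow> mpoly" where
  "mVar i = Poly_Mapping.single (Poly_Mapping.single i 1) 1"

definition meval :: "mpoly \<Rightarrow> (nat \<Rightarrow> int) \<Rightarrow> int" where
  "meval P x = (\<Sum>t\<in>Poly_Mapping.keys P. Poly_Mapping.lookup P t *
     (\<Prod>j\<in>Poly_Mapping.keys t. x j ^ Poly_Mapping.lookup t j))"

text \<open>The supremum of the empty set of extended reals is \<open>-\<infinity>\<close>, so the zero polynomial has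
  degree \<open>-\<infinity>\<close>.\<close>

definition mdegree_in :: "nat \<Rightarrow> mpoly \<Rightarrow> ereal" where
  "mdegree_in j P = (SUP t\<in>Poly_Mapping.keys P. ereal (real (Poly_Mapping.lookup t j)))"

definition mdegree :: "mpoly \<Rightarrow> ereal" where
  "mdegree P = (SUP t\<in>Poly_Mapping.keys P.
     ereal (real (\<Sum>j\<in>Poly_Mapping.keys t. Poly_Mapping.lookup t j)))"

definition system_degree :: "nat \<Rightarrow> (nat \<Rightarrow> mpoly) \<Rightarrow> ereal" where
  "system_degree m F = (SUP i\<in>{..m}. mdegree (F i))"

definition Fp_polys :: "nat \<Rightarrow> nat set \<Rightarrow> mpoly set" where
  "Fp_polys p I = {P. (\<forall>t. Poly_Mapping.lookup P t \<in> {0..<int p}) \<and>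
                      (\<forall>t\<in>Poly_Mapping.keys P. Poly_Mapping.keys t \<subseteq> I)}"

definition Fp_eq :: "nat \<Rightarrow> mpoly \<Rightarrow> mpoly \<Rightarrow> bool" where
  "Fp_eq p P Q \<longleftrightarrow>
     (\<forall>t. [Poly_Mapping.lookup P t = Poly_Mapping.lookup Q t] (mod int p))"

definition exponent_matrix :: "nat \<Rightarrow> nat mat \<Rightarrow> bool" where
  "exponent_matrix m S \<longleftrightarrow>
     S \<in> carrier_mat (m + 1) (m + 1) \<and> upper_triangular S \<and> (\<forall>i\<le>m. S $$ (i, i) = 1)"

text \<open>Only the components \<open>F 0, \<dots>, F m\<close> of a system are relevant.\<close>

definition triangular_systems :: "nat \<Rightarrow> nat \<Rightarrow> nat mat \<Rightarrow> (nat \<Rightarrow> mpoly) set" where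
  "triangular_systems p m S = {F.
     (\<forall>i\<le>m. F i \<in> Fp_polys p {..m}) \<and>
     (\<forall>i<m. \<exists>G H G' g.
        G \<in> Fp_polys p {i+1..m} \<and> H \<in> Fp_polys p {i+1..m} \<and> G' \<in> Fp_polys p {i+1..m} \<and>
        g \<in> {1..<int p} \<and>
        Fp_eq p (F i) (mVar i * G + H) \<and>
        Fp_eq p G (mConst g * (\<Prod>j\<in>{i+1..m}. mVar j ^ (S $$ (i, j))) + G') \<and>
        (\<forall>j\<in>{i+1..m}. mdegree_in j G' < ereal (real (S $$ (i, j))) \<and>
                        mdegree_in j H \<le> ereal (real (S $$ (i, j))))) \<and>
     (\<exists>g\<in>{1..<int p}. \<exists>h\<in>{0..<int p}.
        Fp_eq p (F m) (mConst g * mVar m + mConst h))}"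

primrec iterates :: "nat \<Rightarrow> nat \<Rightarrow> (nat \<Rightarrow> mpoly) \<Rightarrow> (nat \<Rightarrow> int) \<Rightarrow> nat \<Rightarrow> nat \<Rightarrow> int" where
  "iterates p m F w\<^sub>0 0 = w\<^sub>0"
| "iterates p m F w\<^sub>0 (Suc n) = (\<lambda>i\<in>{..m}. meval (F i) (iterates p m F w\<^sub>0 n) mod int p)"

definition purely_periodic :: "(nat \<Rightarrow> 'a) \<Rightarrow> nat \<Rightarrow> bool" where
  "purely_periodic w \<tau> \<longleftrightarrow>
     \<tau> > 0 \<and> (\<forall>n. w (n + \<tau>) = w n) \<and> (\<forall>t. 0 < t \<and> (\<forall>n. w (n + t) = w n) \<longrightarrow> \<tau> \<le> t)"

text \<open>Discrepancy of the first \<open>N\<close> points of \<open>x\<close> in dimension \<open>s\<close>; the point with index \<open>n\<close> has the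
  coordinates \<open>x n 0, \<dots>, x n (s - 1)\<close>. Empty boxes contribute \<open>0\<close> to the supremum.\<close>

definition discrepancy :: "nat \<Rightarrow> nat \<Rightarrow> (nat \<Rightarrow> nat \<Rightarrow> real) \<Rightarrow> real" where
  "discrepancy s N x = Sup {\<bar>real (card {n. n < N \<and> (\<forall>i<s. x n i \<in> {a i..<b i})}) / real N
       - (\<Prod>i<s. b i - a i)\<bar> | a b. \<forall>i<s. 0 \<le> a i \<and> a i \<le> b i \<and> b i \<le> 1}"

end

theory Submission
  imports
    Defs
    "HOL-Computational_Algebra.Polynomial"
    "HOL-Analysis.Convex"
    "HOL-Analysis.Harmonic_Numbers"
    "HOL-Library.Real_Mod"
begin

text \<open>
  Write \<open>T\<close> for the map on \<open>{0..<p}\<^sup>m\<^sup>+\<^sup>1\<close> that the system induces. The triangular shape survives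
  iteration: modulo \<open>p\<close>, coordinate \<open>i\<close> of \<open>T ^^ k\<close> at \<open>x\<close> is \<open>x i * G i k x + b\<close>, where \<open>b\<close> and
  \<open>G i k x = (\<Prod>t<k. g i ((T ^^ t) x))\<close> depend only on the coordinates after \<open>i\<close>. A sum of
  additive characters over all states, evaluated at a combination of iterates whose first relevant
  coordinate is \<open>i\<close>, can therefore be summed over \<open>x i\<close> first. The inner sum vanishes unless \<open>p\<close>
  divides the corresponding combination of the \<open>G i k\<close>, so the complete sum is at most the number
  of zeros of that combination (\<open>norm_states_sum_le\<close>). This saves a full factor \<open>p\<close> over the
  trivial estimate, where a bound of Weil type would save only its square root.

  These zeros are few because, as a polynomial in \<open>x (i + 1)\<close> alone, \<open>G i k\<close> has formal degree
  \<open>k * s i\<close> with \<open>s i = s\<^sub>i\<^sub>,\<^sub>i\<^sub>+\<^sub>1 > 0\<close>. These degrees strictly increase with \<open>k\<close>, so the leading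
  coefficient of a combination comes from its last term and cannot cancel. Up to a constant it is a
  product of powers of slopes \<open>G j t\<close> and of coordinates of iterates, all with larger index, so it
  rarely vanishes: descending induction on \<open>i\<close> gives \<open>O(K\<^sup>m p\<^sup>m)\<close> zeros for \<open>k < K\<close>
  (\<open>card_comb_zeros_le\<close>).

  The orbit sum is compared with its average over \<open>K\<close> shifts and raised to the power \<open>2\<nu>\<close>. As the
  points of the orbit are distinct, the sum over the orbit may be extended to all states, where the
  power expands into pairs of \<open>\<nu>\<close>-tuples of iteration counts (\<open>moment_le\<close>). If \<open>p > \<nu>\<close>, only
  \<open>O(K\<^sup>\<nu>)\<close> pairs can fail to give a nontrivial combination, whence a total of
  \<open>O(K\<^sup>\<nu> p\<^sup>m\<^sup>+\<^sup>1 + K\<^sup>2\<^sup>\<nu>\<^sup>+\<^sup>m p\<^sup>m)\<close>. The two terms balance when \<open>K\<close> is about the \<open>(m + \<nu>)\<close>-th root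
  of \<open>p\<close>, and this choice gives the exponents of the bound (\<open>norm_orbit_sum_le\<close>).

  Finally, expanding the indicator function of a box into characters turns the bound for exponential
  sums into one for the discrepancy. The Fourier coefficients of an interval have absolute sum at
  most \<open>2 + ln p\<close>, which accounts for the logarithms (\<open>discrepancy_le\<close>).
\<close>

section \<open>Additive characters modulo p\<close>

text \<open>The standard additive character \<open>exp (2 \<pi> i z / p)\<close> of the integers modulo \<open>p\<close>.\<close>
definition ep :: "nat \<Rightarrow> int \<Rightarrow> complex" where
  "ep p z = cis (2 * pi * real_of_int z / real p)"

lemma ep_0 [simp]: "ep p 0 = 1"
  by (simp add: ep_def)

lemma norm_ep [simp]: "norm (ep p z) = 1"
  by (simp add: ep_def)

lemma ep_add: "ep p (a + b) = ep p a * ep p b"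
  by (simp add: ep_def cis_mult distrib_left add_divide_distrib)

lemma ep_minus: "ep p (- a) = cnj (ep p a)"
  by (simp add: ep_def cis_cnj)

lemma ep_sum: "ep p (\<Sum>j\<in>A. f j) = (\<Prod>j\<in>A. ep p (f j))"
  by (induction A rule: infinite_finite_induct) (simp_all add: ep_add)

lemma ep_of_nat_mult: "ep p (int n * a) = ep p a ^ n"
  by (induction n) (simp_all add: ep_add distrib_right)

lemma ep_eq_1_iff:
  assumes "p > 0"
  shows "ep p z = 1 \<longleftrightarrow> int p dvd z"
proof -
  have "ep p z = 1 \<longleftrightarrow> (\<exists>n::int. real_of_int z = real_of_int n * real p)"
    using assms by (auto simp: ep_def cis_eq_1_iff field_simps)
  also have "\<dots> \<longleftrightarrow> (\<exists>n. z = n * int p)"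
    by (metis of_int_eq_iff of_int_mult of_int_of_nat_eq)
  also have "\<dots> \<longleftrightarrow> int p dvd z"
    by (auto simp: dvd_def mult.commute)
  finally show ?thesis .
qed

lemma ep_cong:
  assumes "p > 0" "[a = b] (mod int p)"
  shows "ep p a = ep p b"
proof -
  have "ep p (a - b) = 1"
    using assms by (simp add: ep_eq_1_iff cong_iff_dvd_diff)
  thus ?thesis
    using ep_add[of p "a - b" b] by simp
qed

lemma sum_int_interval: "(\<Sum>y\<in>{0..<int p}. f y) = (\<Sum>n<p. f (int n))"
  by (rule sum.reindex_bij_witness[of _ int nat]) auto

lemma sum_ep:
  assumes "p > 0"
  shows "(\<Sum>y\<in>{0..<int p}. ep p (y * a)) = (if int p dvd a then of_nat p else 0)"
proof (cases "int p dvd a")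
  case True
  hence "ep p (y * a) = 1" for y using assms by (simp add: ep_eq_1_iff)
  thus ?thesis using True by simp
next
  case False
  hence "ep p a \<noteq> 1" using assms by (simp add: ep_eq_1_iff)
  moreover have "ep p a ^ p = 1"
    using assms by (simp flip: ep_of_nat_mult add: ep_eq_1_iff)
  ultimately show ?thesis using False
    by (simp add: sum_int_interval ep_of_nat_mult geometric_sum)
qed

text \<open>
  The sine is concave on \<open>{0..pi}\<close>, so it lies above its chord from \<open>0\<close> to \<open>pi / 2\<close>.
\<close>
lemma sin_ge_chord:
  assumes "0 \<le> t" "t \<le> 1"
  shows "t \<le> sin (t * (pi / 2))"
proof -
  have "concave_on {0..pi} sin"
    by (rule f''_le0_imp_concave[where f' = cos and f'' = "\<lambda>x. - sin x"])
       (auto intro!: derivative_eq_intros sin_ge_zero)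
  from concave_onD[OF this, of t 0 "pi/2"] assms show ?thesis by (simp add: algebra_simps)
qed

text \<open>
  The denominator of the geometric sums that occur as Fourier coefficients of intervals: it is
  bounded below by the distance from \<open>h\<close> to the nearest multiple of \<open>p\<close>.
\<close>
lemma norm_ep_minus_1_ge:
  assumes "p > 0" "0 \<le> h" "h \<le> int p"
  shows "norm (ep p h - 1) \<ge> 4 * min (real_of_int h) (real p - real_of_int h) / real p"
proof -
  (* The distance from h / p to the nearest integer, doubled so that it ranges over {0..1}. *)
  define t where "t = 2 * min (real_of_int h) (real p - real_of_int h) / real p"
  have t: "0 \<le> t" "t \<le> 1"
    using assms by (auto simp: t_def min_def field_simps)
  have "sin (t * (pi/2)) = sin (pi * h / real p)"
  proof (cases "real_of_int h \<le> real p - real_of_int h")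
    case True
    thus ?thesis by (simp add: t_def mult.commute)
  next
    case False
    hence "t * (pi/2) = pi - pi * h / real p"
      using assms by (simp add: t_def field_simps)
    thus ?thesis by (simp only: sin_pi_minus)
  qed
  moreover have "norm (ep p h - 1) = 2 * \<bar>sin (pi * h / real p)\<bar>"
  proof -
    define x where "x = pi * h / real p"
    have "ep p h - 1 = cis x * (cis x - cis (- x))"
      by (simp add: ep_def x_def cis_mult right_diff_distrib add_divide_distrib [symmetric] mult.assoc)
    also have "cis x - cis (- x) = 2 * \<i> * complex_of_real (sin x)"
      by (simp add: complex_eq_iff)
    finally show ?thesis by (simp add: norm_mult x_def)
  qed
  ultimately show ?thesis
    using sin_ge_chord[OF t] by (simp add: t_def)
qed

section \<open>From exponential sums to discrepancy\<close>

definition fourier_coeff :: "nat \<Rightarrow> int set \<Rightarrow> int \<Rightarrow> complex" where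
  "fourier_coeff p I h = (\<Sum>v\<in>I. ep p (- (v * h))) / of_nat p"

lemma fourier_inversion:
  assumes "I \<subseteq> {0..<int p}" "u \<in> {0..<int p}"
  shows "of_bool (u \<in> I) = (\<Sum>h\<in>{0..<int p}. fourier_coeff p I h * ep p (h * u))"
proof -
  have p: "p > 0" using assms(2) by auto
  have [simp]: "finite I" using assms(1) finite_subset by blast
  have dvd: "int p dvd u - v \<longleftrightarrow> v = u" if "v \<in> I" for v
  proof -
    have "v \<in> {0..<int p}" using that assms(1) by blast
    thus ?thesis using assms(2) zdvd_imp_le[of "int p" "u - v"] zdvd_imp_le[of "int p" "v - u"]
      by (cases u v rule: linorder_cases) (auto simp: dvd_diff_commute)
  qed
  have "(\<Sum>h\<in>{0..<int p}. fourier_coeff p I h * ep p (h * u))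
      = (\<Sum>h\<in>{0..<int p}. \<Sum>v\<in>I. ep p (h * (u - v))) / of_nat p"
  proof -
    have "ep p (h * (u - v)) = ep p (- (v * h)) * ep p (h * u)" for h v
      by (simp flip: ep_add add: algebra_simps)
    thus ?thesis
      by (simp add: fourier_coeff_def sum_divide_distrib sum_distrib_right)
  qed
  also have "(\<Sum>h\<in>{0..<int p}. \<Sum>v\<in>I. ep p (h * (u - v))) = (\<Sum>v\<in>I. if v = u then of_nat p else 0)"
    by (subst sum.swap, rule sum.cong) (simp_all add: sum_ep p dvd)
  also have "\<dots> / of_nat p = of_bool (u \<in> I)"
    using p by (simp add: of_bool_def)
  finally show ?thesis ..
qed

text \<open>
  The coefficient of an interval is a geometric sum. Replacing the reciprocal of
  \<open>min h (p - h)\<close> by the sum of both reciprocals keeps the bound summable in closed form.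
\<close>
lemma norm_fourier_coeff_interval:
  assumes "0 < h" "h < int p"
  shows "norm (fourier_coeff p {lo..<hi} h) \<le> (1 / real_of_int h + 1 / (real p - real_of_int h)) / 2"
proof -
  have p: "p > 0" using assms by simp
  define z where "z = ep p h"
  define M where "M = min (real_of_int h) (real p - real_of_int h)"
  have M: "M > 0" using assms by (simp add: M_def)
  have z: "norm (z - 1) \<ge> 4 * M / real p"
    unfolding z_def M_def using assms p by (intro norm_ep_minus_1_ge) auto
  have *: "norm (\<Sum>v\<in>{lo..<hi}. ep p (- (v * h))) * norm (z - 1) \<le> 2"
  proof -
    (* The sum over the interval telescopes after multiplication by z - 1. *)
    have tele: "(\<Sum>v\<in>{lo..<lo + int n}. ep p (- (v * h))) * (z - 1)
        = z * (ep p (- (lo * h)) - ep p (- ((lo + int n) * h)))" for n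
    proof (induction n)
      case (Suc n)
      have "{lo..<lo + int (Suc n)} = insert (lo + int n) {lo..<lo + int n}" by auto
      moreover have "ep p (- ((lo + int n) * h)) = z * ep p (- ((lo + int (Suc n)) * h))"
        unfolding z_def by (subst ep_add [symmetric]) (simp add: algebra_simps)
      ultimately show ?case using Suc by (simp add: algebra_simps)
    qed simp
    have "norm ((\<Sum>v\<in>{lo..<hi}. ep p (- (v * h))) * (z - 1)) \<le> 2"
    proof (cases "lo \<le> hi")
      case True
      show ?thesis using tele[of "nat (hi - lo)"] True
          norm_triangle_ineq4[of "ep p (- (lo * h))" "ep p (- (hi * h))"]
        by (simp add: norm_mult z_def)
    qed simp
    thus ?thesis by (simp add: norm_mult)
  qed
  have "norm (\<Sum>v\<in>{lo..<hi}. ep p (- (v * h))) * (4 * M / real p) \<le> 2"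
    using * mult_left_mono[OF z, of "norm (\<Sum>v\<in>{lo..<hi}. ep p (- (v * h)))"] by simp
  hence "norm (fourier_coeff p {lo..<hi} h) \<le> 1 / (2 * M)"
    using p M by (simp add: fourier_coeff_def norm_divide field_simps)
  also have "1 / (2 * M) \<le> (1 / real_of_int h + 1 / (real p - real_of_int h)) / 2"
  proof -
    have "1 / real_of_int h > 0" "1 / (real p - real_of_int h) > 0" using assms by auto
    moreover have "1 / (2 * M) = (1 / M) / 2" by simp
    ultimately show ?thesis unfolding M_def min_def by (auto simp del: divide_divide_eq_left)
  qed
  finally show ?thesis .
qed

lemma harm_le_ln: "n > 0 \<Longrightarrow> (harm n :: real) \<le> 1 + ln (real n)"
  using decseqD[OF decseq_harm_diff_ln, of 0 "n - 1"] by (simp add: harm_def)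

text \<open>
  The coefficient at \<open>0\<close> is at most \<open>1\<close>, and the others are dominated by a harmonic sum.
\<close>
lemma fourier_coeff_interval_l1:
  assumes "0 \<le> lo" "hi \<le> int p" "2 \<le> p"
  shows "(\<Sum>h\<in>{0..<int p}. norm (fourier_coeff p {lo..<hi} h)) \<le> 2 + ln (real p)"
proof -
  have zero: "norm (fourier_coeff p {lo..<hi} 0) \<le> 1"
    using assms by (simp add: fourier_coeff_def norm_divide)
  have rest: "(\<Sum>h\<in>{1..<int p}. norm (fourier_coeff p {lo..<hi} h))
      \<le> (\<Sum>h\<in>{1..<int p}. (1 / real_of_int h + 1 / (real p - real_of_int h)) / 2)"
    by (intro sum_mono norm_fourier_coeff_interval) auto
  have s1: "(\<Sum>h\<in>{1..<int p}. 1 / real_of_int h) = harm (p - 1)"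
    unfolding harm_def
    by (rule sum.reindex_bij_witness[of _ int nat]) (use assms in \<open>auto simp: divide_inverse\<close>)
  have s2: "(\<Sum>h\<in>{1..<int p}. 1 / (real p - real_of_int h)) = (\<Sum>h\<in>{1..<int p}. 1 / real_of_int h)"
    by (rule sum.reindex_bij_witness[of _ "\<lambda>h. int p - h" "\<lambda>h. int p - h"]) auto
  have "harm (p - 1) \<le> 1 + ln (real (p - 1))" using assms by (intro harm_le_ln) auto
  also have "\<dots> \<le> 1 + ln (real p)" using assms by (simp add: ln_mono)
  finally have "(\<Sum>h\<in>{1..<int p}. (1 / real_of_int h + 1 / (real p - real_of_int h)) / 2) \<le> 1 + ln (real p)"
    by (simp add: sum.distrib s1 s2 flip: sum_divide_distrib)
  moreover have "{0..<int p} = insert 0 {1..<int p}" using assms by auto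
  ultimately show ?thesis using zero rest by simp
qed

text \<open>
  After Fourier expansion in every coordinate, the zero frequency contributes the expected number of
  points, and every other frequency an exponential sum, weighted by a product of coefficients.
\<close>
lemma box_count_error:
  fixes u :: "nat \<Rightarrow> nat \<Rightarrow> int"
  assumes p: "2 \<le> p" and "0 \<le> M"
  assumes lohi: "\<And>i. i < m \<Longrightarrow> 0 \<le> lo i" "\<And>i. i < m \<Longrightarrow> hi i \<le> int p"
  assumes u: "\<And>n i. n < N \<Longrightarrow> i < m \<Longrightarrow> u n i \<in> {0..<int p}"
  assumes M: "\<And>h. h \<in> {..<m} \<rightarrow>\<^sub>E {0..<int p} \<Longrightarrow> \<exists>i<m. h i \<noteq> 0 \<Longrightarrow>
     norm (\<Sum>n<N. ep p (\<Sum>i<m. h i * u n i)) \<le> M"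
  shows "\<bar>real (card {n. n < N \<and> (\<forall>i<m. u n i \<in> {lo i..<hi i})})
            - real N * (\<Prod>i<m. real (card {lo i..<hi i}) / real p)\<bar> \<le> M * (2 + ln (real p)) ^ m"
proof -
  define c where "c = (\<lambda>i. fourier_coeff p {lo i..<hi i})"
  define A where "A = {..<m} \<rightarrow>\<^sub>E {0..<int p}"
  define E where "E = (\<lambda>h. \<Sum>n<N. ep p (\<Sum>i<m. h i * u n i))"
  define h0 where "h0 = (\<lambda>i\<in>{..<m}. 0 :: int)"
  define cnt where "cnt = card {n. n < N \<and> (\<forall>i<m. u n i \<in> {lo i..<hi i})}"
  have finA: "finite A" unfolding A_def by (intro finite_PiE) auto
  have h0: "h0 \<in> A" using p by (auto simp: h0_def A_def)
  have nz: "\<exists>i<m. h i \<noteq> 0" if "h \<in> A" "h \<noteq> h0" for h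
  proof (rule ccontr)
    assume "\<not> ?thesis"
    hence "h = h0" using that(1) by (auto simp: A_def h0_def PiE_def extensional_def restrict_def)
    thus False using that(2) by simp
  qed
  have "of_nat cnt = (\<Sum>n<N. of_bool (\<forall>i<m. u n i \<in> {lo i..<hi i}) :: complex)"
  proof -
    have "{n. n < N \<and> (\<forall>i<m. u n i \<in> {lo i..<hi i})} = {..<N} \<inter> {n. \<forall>i<m. u n i \<in> {lo i..<hi i}}"
      by auto
    thus ?thesis unfolding cnt_def by (simp only: sum_of_bool_eq finite_lessThan)
  qed
  also have "\<dots> = (\<Sum>n<N. \<Prod>i<m. of_bool (u n i \<in> {lo i..<hi i}))"
  proof (rule sum.cong[OF refl])
    fix n
    have "(\<Prod>i\<in>J. of_bool (P i)) = (of_bool (\<forall>i\<in>J. P i) :: complex)" if "finite J" for J :: "nat set" and P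
      using that by (induction J) auto
    from this[of "{..<m}"] show "of_bool (\<forall>i<m. u n i \<in> {lo i..<hi i}) = (\<Prod>i<m. of_bool (u n i \<in> {lo i..<hi i}) :: complex)"
      by (simp add: Ball_def)
  qed
  also have "\<dots> = (\<Sum>n<N. \<Prod>i<m. \<Sum>h\<in>{0..<int p}. c i h * ep p (h * u n i))"
    unfolding c_def by (intro sum.cong prod.cong refl fourier_inversion) (use lohi u in force)+
  also have "\<dots> = (\<Sum>n<N. \<Sum>h\<in>A. (\<Prod>i<m. c i (h i)) * ep p (\<Sum>i<m. h i * u n i))"
    unfolding A_def by (subst prod_sum_PiE) (auto simp: ep_sum prod.distrib)
  also have "\<dots> = (\<Sum>h\<in>A. (\<Prod>i<m. c i (h i)) * E h)"
    unfolding E_def sum_distrib_left by (rule sum.swap)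
  also have "\<dots> = (\<Prod>i<m. c i (h0 i)) * E h0 + (\<Sum>h\<in>A - {h0}. (\<Prod>i<m. c i (h i)) * E h)"
    by (rule sum.remove[OF finA h0])
  also have "(\<Prod>i<m. c i (h0 i)) * E h0 = of_real (real N * (\<Prod>i<m. real (card {lo i..<hi i}) / real p))"
    by (simp add: E_def h0_def c_def fourier_coeff_def mult.commute)
  finally have eq: "complex_of_real (real cnt - real N * (\<Prod>i<m. real (card {lo i..<hi i}) / real p))
      = (\<Sum>h\<in>A - {h0}. (\<Prod>i<m. c i (h i)) * E h)"
    by simp
  have "\<bar>real cnt - real N * (\<Prod>i<m. real (card {lo i..<hi i}) / real p)\<bar>
      = norm (\<Sum>h\<in>A - {h0}. (\<Prod>i<m. c i (h i)) * E h)"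
    unfolding eq [symmetric] norm_of_real ..
  also have "\<dots> \<le> (\<Sum>h\<in>A - {h0}. (\<Prod>i<m. norm (c i (h i))) * M)"
  proof (rule sum_norm_le)
    fix h assume "h \<in> A - {h0}"
    hence "norm (E h) \<le> M" using M[of h] nz[of h] by (simp add: E_def A_def)
    thus "norm ((\<Prod>i<m. c i (h i)) * E h) \<le> (\<Prod>i<m. norm (c i (h i))) * M"
      by (simp add: norm_mult prod_norm mult_left_mono)
  qed
  also have "\<dots> \<le> (\<Sum>h\<in>A. (\<Prod>i<m. norm (c i (h i))) * M)"
    using \<open>0 \<le> M\<close> by (intro sum_mono2 finA mult_nonneg_nonneg prod_nonneg) auto
  also have "\<dots> = (\<Prod>i<m. \<Sum>h\<in>{0..<int p}. norm (c i h)) * M"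
    unfolding A_def by (subst prod_sum_PiE) (auto simp: sum_distrib_right)
  also have "\<dots> \<le> (\<Prod>i<m. 2 + ln (real p)) * M"
    unfolding c_def using p \<open>0 \<le> M\<close> lohi
    by (intro mult_right_mono prod_mono conjI sum_nonneg fourier_coeff_interval_l1) auto
  finally show ?thesis by (simp add: cnt_def mult.commute)
qed

text \<open>
  A real box contains the same points \<open>u / p\<close> as a box of integers. Each side of that box, scaled by
  \<open>1 / p\<close>, differs from the real side by at most \<open>1 / p\<close>, which changes the volume by at most \<open>m / p\<close>.
\<close>
lemma discrepancy_le:
  fixes u :: "nat \<Rightarrow> nat \<Rightarrow> int"
  assumes p: "2 \<le> p" and N: "N > 0" and "0 \<le> M"
  assumes u: "\<And>n i. n < N \<Longrightarrow> i < m \<Longrightarrow> u n i \<in> {0..<int p}"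
  assumes M: "\<And>h. h \<in> {..<m} \<rightarrow>\<^sub>E {0..<int p} \<Longrightarrow> \<exists>i<m. h i \<noteq> 0 \<Longrightarrow>
     norm (\<Sum>n<N. ep p (\<Sum>i<m. h i * u n i)) \<le> M"
  shows "discrepancy m N (\<lambda>n i. real_of_int (u n i) / real p)
           \<le> real m / real p + M / real N * (2 + ln (real p)) ^ m"
  unfolding discrepancy_def
proof (rule cSup_least)
  show "{\<bar>real (card {n. n < N \<and> (\<forall>i<m. real_of_int (u n i) / real p \<in> {a i..<b i})}) / real N
       - (\<Prod>i<m. b i - a i)\<bar> | a b. \<forall>i<m. 0 \<le> a i \<and> a i \<le> b i \<and> b i \<le> 1} \<noteq> {}"
    by (auto intro!: exI[of _ "\<lambda>_. 0"])
next
  fix y assume "y \<in> {\<bar>real (card {n. n < N \<and> (\<forall>i<m. real_of_int (u n i) / real p \<in> {a i..<b i})}) / real N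
       - (\<Prod>i<m. b i - a i)\<bar> | a b. \<forall>i<m. 0 \<le> a i \<and> a i \<le> b i \<and> b i \<le> 1}"
  then obtain a b where y: "y = \<bar>real (card {n. n < N \<and> (\<forall>i<m. real_of_int (u n i) / real p \<in> {a i..<b i})}) / real N
       - (\<Prod>i<m. b i - a i)\<bar>" and ab: "\<And>i. i < m \<Longrightarrow> 0 \<le> a i \<and> a i \<le> b i \<and> b i \<le> 1"
    by auto
  define lo where "lo = (\<lambda>i. \<lceil>real p * a i\<rceil>)"
  define hi where "hi = (\<lambda>i. \<lceil>real p * b i\<rceil>)"
  define V where "V = (\<lambda>i. real (card {lo i..<hi i}) / real p)"
  have lohi: "0 \<le> lo i" "lo i \<le> hi i" "hi i \<le> int p" if "i < m" for i
  proof -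
    have "0 \<le> real p * a i" "real p * a i \<le> real p * b i" "real p * b i \<le> real p"
      using ab[OF that] by (auto simp: mult_left_le intro: mult_left_mono)
    thus "0 \<le> lo i" "lo i \<le> hi i" "hi i \<le> int p"
      unfolding lo_def hi_def by (linarith, simp add: ceiling_mono, simp add: ceiling_le_iff)
  qed
  have mem: "real_of_int v / real p \<in> {a i..<b i} \<longleftrightarrow> v \<in> {lo i..<hi i}" for v i
    using p by (auto simp: lo_def hi_def ceiling_le_iff less_ceiling_iff field_simps)
  have V: "\<bar>V i - (b i - a i)\<bar> \<le> 1 / real p" "V i \<le> 1" if "i < m" for i
  proof -
    have "real (card {lo i..<hi i}) = real_of_int (hi i) - real_of_int (lo i)"
      using lohi[OF that] by simp
    moreover have "\<bar>real_of_int (hi i) - real_of_int (lo i) - real p * (b i - a i)\<bar> \<le> 1"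
      unfolding lo_def hi_def by (simp add: algebra_simps) linarith
    ultimately have "\<bar>real p * (V i - (b i - a i))\<bar> \<le> 1"
      using p by (simp add: V_def right_diff_distrib [of "real p" "_ / _"])
    hence "real p * \<bar>V i - (b i - a i)\<bar> \<le> 1" by (simp only: abs_mult abs_of_nat)
    thus "\<bar>V i - (b i - a i)\<bar> \<le> 1 / real p" using p by (simp add: le_divide_eq mult.commute)
    show "V i \<le> 1" using lohi[OF that] p by (simp add: V_def)
  qed
  define cnt where "cnt = real (card {n. n < N \<and> (\<forall>i<m. u n i \<in> {lo i..<hi i})})"
  have "\<bar>cnt / real N - (\<Prod>i<m. V i)\<bar> = \<bar>cnt - real N * (\<Prod>i<m. V i)\<bar> / real N"
  proof -
    have "cnt / real N - (\<Prod>i<m. V i) = (cnt - real N * (\<Prod>i<m. V i)) / real N"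
      using N by (simp add: diff_divide_distrib)
    thus ?thesis by (simp only: abs_divide abs_of_nat)
  qed
  also have "\<dots> \<le> M * (2 + ln (real p)) ^ m / real N"
    unfolding cnt_def V_def using p u lohi M \<open>0 \<le> M\<close>
    by (intro divide_right_mono box_count_error) auto
  finally have 1: "\<bar>cnt / real N - (\<Prod>i<m. V i)\<bar> \<le> M / real N * (2 + ln (real p)) ^ m" by simp
  have "\<bar>(\<Prod>i<m. V i) - (\<Prod>i<m. b i - a i)\<bar> \<le> (\<Sum>i<m. \<bar>V i - (b i - a i)\<bar>)"
    using norm_prod_diff[of "{..<m}" V "\<lambda>i. b i - a i"] V(2) ab by (force simp: V_def)
  also have "\<dots> \<le> (\<Sum>i<m. 1 / real p)"
    using V by (intro sum_mono) auto
  finally have 2: "\<bar>(\<Prod>i<m. V i) - (\<Prod>i<m. b i - a i)\<bar> \<le> real m / real p" by simp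
  have "y = \<bar>cnt / real N - (\<Prod>i<m. b i - a i)\<bar>" unfolding y cnt_def by (simp only: mem)
  thus "y \<le> real m / real p + M / real N * (2 + ln (real p)) ^ m" using 1 2 by linarith
qed

section \<open>Polynomial functions modulo a prime\<close>

lemma poly_cong_arg:
  fixes a b :: int
  assumes "[a = b] (mod n)"
  shows "[poly Q a = poly Q b] (mod n)"
  by (induction Q) (simp_all add: assms cong_add cong_mult)

text \<open>
  Here \<open>a\<close> and \<open>b\<close> are only upper bounds for the degrees, so the coefficients on the right may be \<open>0\<close>;
  this is what allows degrees to be tracked before any leading coefficient is known to be nonzero.
\<close>
lemma coeff_mult_top:
  assumes "degree P \<le> a" "degree Q \<le> b"
  shows "coeff (P * Q) (a + b) = coeff P a * coeff Q b"
proof -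
  have "coeff (P * Q) (a + b) = (\<Sum>i\<le>a + b. coeff P i * coeff Q (a + b - i))"
    by (rule coeff_mult)
  also have "\<dots> = (\<Sum>i\<in>{a}. coeff P i * coeff Q (a + b - i))"
  proof (intro sum.mono_neutral_right ballI)
    fix i assume "i \<in> {..a + b} - {a}"
    hence "i > a \<or> a + b - i > b" by auto
    thus "coeff P i * coeff Q (a + b - i) = 0"
      using assms coeff_eq_0[of P i] coeff_eq_0[of Q "a + b - i"] by auto
  qed auto
  finally show ?thesis by simp
qed

lemma coeff_pcompose_linear:
  fixes Q :: "'a :: comm_ring_1 poly"
  assumes "degree Q \<le> n"
  shows "degree (pcompose Q [:b, a:]) \<le> n \<and> coeff (pcompose Q [:b, a:]) n = coeff Q n * a ^ n"
  using assms
proof (induction Q arbitrary: n rule: pCons_induct)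
  case 0
  thus ?case by simp
next
  case (pCons c Q)
  show ?case
  proof (cases n)
    case 0
    hence "Q = 0" using pCons.prems pCons.hyps by (auto split: if_splits)
    thus ?thesis using 0 by (simp add: pcompose_pCons)
  next
    case (Suc n')
    hence deg: "degree Q \<le> n'" using pCons.prems by (auto split: if_splits)
    note IH = pCons.IH[OF deg]
    have lin: "degree [:b, a:] \<le> 1" by simp
    have "degree ([:b, a:] * pcompose Q [:b, a:]) \<le> 1 + n'"
      using IH lin by (meson add_mono degree_mult_le order_trans)
    moreover have "coeff ([:b, a:] * pcompose Q [:b, a:]) (1 + n') = a * (coeff Q n' * a ^ n')"
      using IH coeff_mult_top[OF lin, of "pcompose Q [:b, a:]" n'] by simp
    ultimately show ?thesis
      unfolding pcompose_pCons Suc by (auto intro: degree_add_le simp: mult_ac)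
  qed
qed

text \<open>
  Dividing by the linear factor of a root modulo \<open>p\<close> leaves a remainder that \<open>p\<close> divides, so every
  other root is a root of the quotient.
\<close>
lemma card_roots_mod_prime:
  fixes Q :: "int poly"
  assumes "prime p" "degree Q \<le> n" "\<not> int p dvd coeff Q n"
  shows "card {y \<in> {0..<int p}. int p dvd poly Q y} \<le> n"
  using assms(2,3)
proof (induction n arbitrary: Q)
  case 0
  then obtain c where "Q = [:c:]" using degree_eq_zeroE by auto
  thus ?case using 0 by simp
next
  case (Suc n)
  show ?case
  proof (cases "{y \<in> {0..<int p}. int p dvd poly Q y} = {}")
    case True
    show ?thesis unfolding True by simp
  next
    case False
    then obtain a where a: "a \<in> {0..<int p}" "int p dvd poly Q a" by blast
    define R where "R = synthetic_div Q a"
    have Q: "Q = [:-a, 1:] * R + [:poly Q a:]"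
      unfolding R_def by (rule synthetic_div_correct' [symmetric])
    have deg: "degree R \<le> n" using Suc.prems by (simp add: R_def degree_synthetic_div)
    have "coeff ([:-a, 1:] * R) (1 + n) = coeff R n"
      using coeff_mult_top[of "[:-a, 1:]" 1 R n] deg by simp
    hence "coeff Q (Suc n) = coeff R n" by (subst Q) simp
    hence IH: "card {y \<in> {0..<int p}. int p dvd poly R y} \<le> n"
      using Suc deg by simp
    have "y = a \<or> int p dvd poly R y" if y: "y \<in> {0..<int p}" "int p dvd poly Q y" for y
    proof -
      have "poly Q y = (y - a) * poly R y + poly Q a" by (subst Q) (simp add: algebra_simps)
      hence "int p dvd (y - a) * poly R y" using y(2) a(2) by (simp add: dvd_add_left_iff)
      hence "int p dvd y - a \<or> int p dvd poly R y"
        using \<open>prime p\<close> by (simp add: prime_dvd_mult_iff)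
      moreover have "y = a" if "int p dvd y - a"
      proof -
        have "[y = a] (mod int p)" using that by (simp add: cong_iff_dvd_diff)
        thus ?thesis using y(1) a(1) by (auto intro: cong_less_imp_eq_int)
      qed
      ultimately show ?thesis by blast
    qed
    hence "card {y \<in> {0..<int p}. int p dvd poly Q y}
        \<le> card (insert a {y \<in> {0..<int p}. int p dvd poly R y})"
      by (intro card_mono) (auto intro: finite_subset[of _ "{0..<int p}"])
    also have "\<dots> \<le> Suc (card {y \<in> {0..<int p}. int p dvd poly R y})"
    proof -
      have "finite {y \<in> {0..<int p}. int p dvd poly R y}"
        by (rule finite_subset[of _ "{0..<int p}"]) auto
      thus ?thesis by (simp only: card_insert_if split: if_splits) simp
    qed
    also have "\<dots> \<le> Suc n" using IH by simp
    finally show ?thesis .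
  qed
qed

text \<open>
  Here \<open>n\<close> is only a formal degree, and \<open>l\<close> is a parameter of its own: in the applications \<open>l\<close> depends
  on further variables, and whether \<open>p\<close> divides it is decided only after products and compositions
  have been formed.
\<close>
definition polyfun :: "nat \<Rightarrow> nat \<Rightarrow> int \<Rightarrow> (int \<Rightarrow> int) \<Rightarrow> bool" where
  "polyfun p n l \<phi> \<longleftrightarrow> (\<exists>Q. degree Q \<le> n \<and> coeff Q n = l \<and>
     (\<forall>y\<in>{0..<int p}. [\<phi> y = poly Q y] (mod int p)))"

lemma polyfun_cong:
  assumes "polyfun p n l \<phi>" "\<And>y. y \<in> {0..<int p} \<Longrightarrow> [\<psi> y = \<phi> y] (mod int p)"
  shows "polyfun p n l \<psi>"
proof -
  obtain Q where Q: "degree Q \<le> n" "coeff Q n = l" "\<And>y. y \<in> {0..<int p} \<Longrightarrow> [\<phi> y = poly Q y] (mod int p)"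
    using assms(1) unfolding polyfun_def by blast
  thus ?thesis using cong_trans[OF assms(2) Q(3)] unfolding polyfun_def by blast
qed

lemma polyfun_const: "polyfun p 0 c (\<lambda>_. c)"
  unfolding polyfun_def by (rule exI[of _ "[:c:]"]) auto

lemma polyfun_linear: "polyfun p 1 a (\<lambda>y. y * a + b)"
  unfolding polyfun_def by (rule exI[of _ "[:b, a:]"]) (auto simp: algebra_simps)

lemma polyfun_mult:
  assumes "polyfun p n l \<phi>" "polyfun p n' l' \<psi>"
  shows "polyfun p (n + n') (l * l') (\<lambda>y. \<phi> y * \<psi> y)"
proof -
  obtain Q where Q: "degree Q \<le> n" "coeff Q n = l" "\<And>y. y \<in> {0..<int p} \<Longrightarrow> [\<phi> y = poly Q y] (mod int p)"
    using assms(1) unfolding polyfun_def by blast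
  obtain R where R: "degree R \<le> n'" "coeff R n' = l'" "\<And>y. y \<in> {0..<int p} \<Longrightarrow> [\<psi> y = poly R y] (mod int p)"
    using assms(2) unfolding polyfun_def by blast
  have "degree (Q * R) \<le> n + n'"
    using Q(1) R(1) by (meson add_mono degree_mult_le order_trans)
  thus ?thesis using Q R coeff_mult_top[OF Q(1) R(1)]
    unfolding polyfun_def by (intro exI[of _ "Q * R"]) (auto intro: cong_mult)
qed

lemma polyfun_prod:
  assumes "finite A" "\<And>t. t \<in> A \<Longrightarrow> polyfun p n (l t) (\<phi> t)"
  shows "polyfun p (card A * n) (\<Prod>t\<in>A. l t) (\<lambda>y. \<Prod>t\<in>A. \<phi> t y)"
  using assms by (induction A) (auto simp: polyfun_const intro: polyfun_mult)

lemma polyfun_add_lower: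
  assumes "polyfun p n l \<phi>" "polyfun p n' l' \<psi>" "n' < n"
  shows "polyfun p n l (\<lambda>y. \<psi> y + \<phi> y)"
proof -
  obtain Q where Q: "degree Q \<le> n" "coeff Q n = l" "\<And>y. y \<in> {0..<int p} \<Longrightarrow> [\<phi> y = poly Q y] (mod int p)"
    using assms(1) unfolding polyfun_def by blast
  obtain R where R: "degree R \<le> n'" "coeff R n' = l'" "\<And>y. y \<in> {0..<int p} \<Longrightarrow> [\<psi> y = poly R y] (mod int p)"
    using assms(2) unfolding polyfun_def by blast
  have "coeff R n = 0" using R(1) assms(3) by (simp add: coeff_eq_0)
  moreover have "degree (R + Q) \<le> n" using Q R assms(3) by (auto intro: degree_add_le)
  ultimately show ?thesis using Q R
    unfolding polyfun_def by (intro exI[of _ "R + Q"]) (auto intro: cong_add)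
qed

lemma polyfun_compose_linear:
  assumes "polyfun p n l \<phi>"
    and "\<And>y. y \<in> {0..<int p} \<Longrightarrow> \<psi> y \<in> {0..<int p} \<and> [\<psi> y = y * a + b] (mod int p)"
  shows "polyfun p n (l * a ^ n) (\<lambda>y. \<phi> (\<psi> y))"
proof -
  obtain Q where Q: "degree Q \<le> n" "coeff Q n = l" "\<And>y. y \<in> {0..<int p} \<Longrightarrow> [\<phi> y = poly Q y] (mod int p)"
    using assms(1) unfolding polyfun_def by blast
  have "[\<phi> (\<psi> y) = poly (pcompose Q [:b, a:]) y] (mod int p)" if "y \<in> {0..<int p}" for y
  proof -
    have "[\<phi> (\<psi> y) = poly Q (\<psi> y)] (mod int p)" using Q(3) assms(2) that by blast
    also have "[poly Q (\<psi> y) = poly Q (y * a + b)] (mod int p)"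
      using assms(2) that by (blast intro: poly_cong_arg)
    also have "poly Q (y * a + b) = poly (pcompose Q [:b, a:]) y"
      by (simp add: poly_pcompose algebra_simps)
    finally show ?thesis .
  qed
  thus ?thesis using Q coeff_pcompose_linear[OF Q(1), of b a]
    unfolding polyfun_def by (intro exI[of _ "pcompose Q [:b, a:]"]) auto
qed

lemma card_zeros_polyfun:
  assumes "prime p" "polyfun p n l \<phi>" "\<not> int p dvd l"
  shows "card {y \<in> {0..<int p}. int p dvd \<phi> y} \<le> n"
proof -
  obtain Q where Q: "degree Q \<le> n" "coeff Q n = l" "\<And>y. y \<in> {0..<int p} \<Longrightarrow> [\<phi> y = poly Q y] (mod int p)"
    using assms(2) unfolding polyfun_def by blast
  have "{y \<in> {0..<int p}. int p dvd \<phi> y} = {y \<in> {0..<int p}. int p dvd poly Q y}"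
    using Q(3) cong_dvd_iff by blast
  thus ?thesis using card_roots_mod_prime[OF assms(1) Q(1)] Q(2) assms(3) by simp
qed

section \<open>Counting states along a coordinate\<close>

definition states :: "nat \<Rightarrow> nat \<Rightarrow> (nat \<Rightarrow> int) set" where
  "states p m = {..m} \<rightarrow>\<^sub>E {0..<int p}"

lemma finite_states: "finite (states p m)"
  unfolding states_def by (intro finite_PiE) auto

lemma card_states: "card (states p m) = p ^ (m + 1)"
  by (simp add: states_def card_PiE)

lemma states_upd:
  fixes p m i :: nat
  assumes "x \<in> states p m" "i \<le> m" "y \<in> {0..<int p}"
  shows "x(i := y) \<in> states p m"
  using assms by (auto simp: states_def PiE_def extensional_def)

lemma states_mem: "x \<in> states p m \<Longrightarrow> i \<le> m \<Longrightarrow> x i \<in> {0..<int p}"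
  by (auto simp: states_def)

text \<open>
  The map \<open>(x, y) \<mapsto> (x(i := y), x i)\<close> is an involution on pairs of a state and a residue.
\<close>
lemma sum_states_fiber:
  fixes \<phi> :: "(nat \<Rightarrow> int) \<Rightarrow> 'a :: semiring_1"
  assumes "i \<le> m"
  shows "(\<Sum>x\<in>states p m. \<Sum>y\<in>{0..<int p}. \<phi> (x(i := y))) = of_nat p * (\<Sum>x\<in>states p m. \<phi> x)"
proof -
  have "(\<Sum>x\<in>states p m. \<Sum>y\<in>{0..<int p}. \<phi> (x(i := y)))
      = (\<Sum>(x, y)\<in>states p m \<times> {0..<int p}. \<phi> (x(i := y)))"
    by (rule sum.cartesian_product)
  also have "\<dots> = (\<Sum>(x, y)\<in>states p m \<times> {0..<int p}. \<phi> x)"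
    by (rule sum.reindex_bij_witness[of _ "\<lambda>(x, y). (x(i := y), x i)" "\<lambda>(x, y). (x(i := y), x i)"])
       (use assms states_upd states_mem[of _ p m i] in auto)
  also have "\<dots> = (\<Sum>x\<in>states p m. \<Sum>y\<in>{0..<int p}. \<phi> x)"
    by (rule sum.cartesian_product [symmetric])
  also have "\<dots> = of_nat p * (\<Sum>x\<in>states p m. \<phi> x)"
    by (simp add: sum_distrib_left)
  finally show ?thesis .
qed

text \<open>
  A Schwartz-Zippel step: outside an exceptional set that does not depend on coordinate \<open>i\<close>, every line
  in direction \<open>i\<close> contains at most \<open>n\<close> points.
\<close>
lemma card_states_fiber_le:
  assumes "p > 0" "i \<le> m"
    and B: "\<And>x y. x \<in> states p m \<Longrightarrow> y \<in> {0..<int p} \<Longrightarrow> B (x(i := y)) \<longleftrightarrow> B x"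
    and n: "\<And>x. x \<in> states p m \<Longrightarrow> \<not> B x \<Longrightarrow> card {y \<in> {0..<int p}. P (x(i := y))} \<le> n"
  shows "card {x \<in> states p m. P x} \<le> card {x \<in> states p m. B x} + n * p ^ m"
proof -
  define A where "A = {x \<in> states p m. P x \<and> \<not> B x}"
  have card_of_bool: "card {z \<in> Z. R z} = (\<Sum>z\<in>Z. of_bool (R z))" if "finite Z" for Z :: "'z set" and R
    using that by (simp add: sum_of_bool_eq Int_def)
  (* Each point of A is counted once for every point of its line, hence p times. *)
  have "p * card A = (\<Sum>x\<in>states p m. \<Sum>y\<in>{0..<int p}. of_bool (P (x(i := y)) \<and> \<not> B (x(i := y))))"
    using sum_states_fiber[OF \<open>i \<le> m\<close>, of "\<lambda>x. of_bool (P x \<and> \<not> B x) :: nat"] finite_states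
    by (simp add: A_def card_of_bool)
  also have "\<dots> \<le> (\<Sum>x\<in>states p m. n)"
  proof (rule sum_mono)
    fix x assume x: "x \<in> states p m"
    have "(\<Sum>y\<in>{0..<int p}. of_bool (P (x(i := y)) \<and> \<not> B (x(i := y))))
        = card {y \<in> {0..<int p}. P (x(i := y)) \<and> \<not> B x}"
      using B[OF x] by (subst card_of_bool) (auto intro: sum.cong)
    also have "\<dots> \<le> n" using n[OF x] by (cases "B x") auto
    finally show "(\<Sum>y\<in>{0..<int p}. of_bool (P (x(i := y)) \<and> \<not> B (x(i := y)))) \<le> n" .
  qed
  also have "\<dots> = p * (n * p ^ m)" by (simp add: card_states)
  finally have "card A \<le> n * p ^ m" using \<open>p > 0\<close> by simp
  moreover have "card {x \<in> states p m. P x} \<le> card ({x \<in> states p m. B x} \<union> A)"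
    using finite_states by (intro card_mono) (auto simp: A_def)
  moreover have "card ({x \<in> states p m. B x} \<union> A) \<le> card {x \<in> states p m. B x} + card A"
    by (rule card_Un_le)
  ultimately show ?thesis by linarith
qed

section \<open>Iterates of triangular maps\<close>

text \<open>
  What the proof needs of a triangular system, with polynomials replaced by the functions that they
  induce: \<open>f i\<close> is affine in \<open>x i\<close> with slope \<open>g i\<close> and offset \<open>h i\<close> depending on later coordinates, and \<open>g i\<close> is a
  polynomial of degree \<open>s i\<close> in \<open>x (i + 1)\<close> whose leading coefficient \<open>l i\<close> depends on later coordinates still
  and can vanish only where one of them does.
\<close>
locale triangular_map =
  fixes p m :: nat and s :: "nat \<Rightarrow> nat" and f g h l :: "nat \<Rightarrow> (nat \<Rightarrow> int) \<Rightarrow> int"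
  assumes prime_p: "prime p"
    and s_pos: "i < m \<Longrightarrow> s i > 0"
    and f_eq: "i \<le> m \<Longrightarrow> x \<in> states p m \<Longrightarrow> [f i x = x i * g i x + h i x] (mod int p)"
    and g_indep: "i \<le> m \<Longrightarrow> (\<And>j. j \<in> {i<..m} \<Longrightarrow> x j = x' j) \<Longrightarrow> g i x = g i x'"
    and h_indep: "i \<le> m \<Longrightarrow> (\<And>j. j \<in> {i<..m} \<Longrightarrow> x j = x' j) \<Longrightarrow> h i x = h i x'"
    and l_indep: "i < m \<Longrightarrow> (\<And>j. j \<in> {Suc i<..m} \<Longrightarrow> x j = x' j) \<Longrightarrow> l i x = l i x'"
    and g_top: "\<not> int p dvd g m x"
    and g_polyfun: "i < m \<Longrightarrow> x \<in> states p m \<Longrightarrow> polyfun p (s i) (l i x) (\<lambda>y. g i (x(Suc i := y)))"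
    and l_nonzero: "i < m \<Longrightarrow> (\<And>j. j \<in> {Suc i<..m} \<Longrightarrow> \<not> int p dvd x j) \<Longrightarrow> \<not> int p dvd l i x"
begin

lemma p_pos: "p > 0"
  using prime_p by (rule prime_gt_0_nat)

definition T :: "(nat \<Rightarrow> int) \<Rightarrow> nat \<Rightarrow> int" where
  "T x = (\<lambda>i\<in>{..m}. f i x mod int p)"

lemma T_apply: "i \<le> m \<Longrightarrow> T x i = f i x mod int p"
  by (simp add: T_def)

lemma T_in_states: "T x \<in> states p m"
  using p_pos by (auto simp: T_def states_def)

lemma Tpow_in_states: "x \<in> states p m \<Longrightarrow> (T ^^ k) x \<in> states p m"
  by (cases k) (auto simp: T_in_states)

lemma Tpow_indep:
  assumes "x \<in> states p m" "x' \<in> states p m" "\<And>j. j \<in> {i<..m} \<Longrightarrow> x j = x' j"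
  shows "j \<in> {i<..m} \<Longrightarrow> (T ^^ k) x j = (T ^^ k) x' j"
proof (induction k arbitrary: j)
  case 0
  thus ?case using assms by simp
next
  case (Suc k)
  let ?y = "(T ^^ k) x" and ?y' = "(T ^^ k) x'"
  have box: "?y \<in> states p m" "?y' \<in> states p m" using assms by (auto intro: Tpow_in_states)
  have eq: "?y i = ?y' i" if "i \<in> {j<..m}" for i using Suc that by auto
  have "[f j ?y = ?y j * g j ?y + h j ?y] (mod int p)" using box Suc.prems by (intro f_eq) auto
  also have "?y j * g j ?y + h j ?y = ?y' j * g j ?y' + h j ?y'"
    using Suc eq g_indep[of j ?y ?y'] h_indep[of j ?y ?y'] by auto
  also have "[?y' j * g j ?y' + h j ?y' = f j ?y'] (mod int p)"
    using box Suc.prems by (intro cong_sym[OF f_eq]) auto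
  finally show ?case using Suc.prems by (simp add: T_apply unique_euclidean_semiring_class.cong_def)
qed

text \<open>
  The slope in \<open>x i\<close> of the \<open>k\<close>-th iterate, a product by the chain rule.
\<close>
definition G :: "nat \<Rightarrow> nat \<Rightarrow> (nat \<Rightarrow> int) \<Rightarrow> int" where
  "G i k x = (\<Prod>t<k. g i ((T ^^ t) x))"

lemma G_indep:
  assumes "i \<le> m" "x \<in> states p m" "x' \<in> states p m" "\<And>j. j \<in> {i<..m} \<Longrightarrow> x j = x' j"
  shows "G i k x = G i k x'"
  unfolding G_def using assms by (intro prod.cong refl g_indep Tpow_indep[of x x' i]) auto

lemma G_top: "\<not> int p dvd G m k x"
  unfolding G_def using prime_p g_top by (subst prime_dvd_prod_iff) auto

text \<open>
  The offset \<open>b\<close> depends on \<open>x\<close> and \<open>k\<close>, but not on the \<open>i\<close>-th coordinate \<open>y\<close>.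
\<close>
lemma Tpow_affine:
  assumes "x \<in> states p m" "i \<le> m"
  shows "\<exists>b. \<forall>y\<in>{0..<int p}. [(T ^^ k) (x(i := y)) i = y * G i k x + b] (mod int p)"
proof (induction k)
  case 0
  show ?case by (rule exI[of _ 0]) (simp add: G_def)
next
  case (Suc k)
  then obtain b where b: "\<And>y. y \<in> {0..<int p} \<Longrightarrow> [(T ^^ k) (x(i := y)) i = y * G i k x + b] (mod int p)"
    by blast
  let ?z = "(T ^^ k) x"
  have "[(T ^^ Suc k) (x(i := y)) i = y * G i (Suc k) x + (b * g i ?z + h i ?z)] (mod int p)"
    if y: "y \<in> {0..<int p}" for y
  proof -
    let ?z' = "(T ^^ k) (x(i := y))"
    have box: "x(i := y) \<in> states p m" "?z' \<in> states p m"
      using assms y by (auto intro!: states_upd Tpow_in_states simp del: fun_upd_apply)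
    have eq: "?z' j = ?z j" if "j \<in> {i<..m}" for j
      using Tpow_indep[OF box(1) assms(1) _ that] by simp
    have "[(T ^^ Suc k) (x(i := y)) i = f i ?z'] (mod int p)"
      using assms by (simp add: T_apply unique_euclidean_semiring_class.cong_def)
    also have "[f i ?z' = ?z' i * g i ?z' + h i ?z'] (mod int p)"
      using assms box by (intro f_eq) auto
    also have "?z' i * g i ?z' + h i ?z' = ?z' i * g i ?z + h i ?z"
      using assms(2) eq g_indep[of i ?z' ?z] h_indep[of i ?z' ?z] by simp
    also have "[\<dots> = (y * G i k x + b) * g i ?z + h i ?z] (mod int p)"
      using b[OF y] by (intro cong_add cong_mult) auto
    also have "(y * G i k x + b) * g i ?z + h i ?z = y * G i (Suc k) x + (b * g i ?z + h i ?z)"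
      by (simp add: G_def algebra_simps)
    finally show ?thesis .
  qed
  thus ?case by blast
qed

text \<open>
  Where the slope is nonzero modulo \<open>p\<close>, an affine function has at most one zero.
\<close>
lemma card_coordinate_zeros:
  assumes "i \<le> m"
  shows "card {x \<in> states p m. int p dvd (T ^^ k) x i} \<le> card {x \<in> states p m. int p dvd G i k x} + p ^ m"
proof -
  have "card {x \<in> states p m. int p dvd (T ^^ k) x i} \<le> card {x \<in> states p m. int p dvd G i k x} + 1 * p ^ m"
  proof (rule card_states_fiber_le[OF p_pos assms])
    fix x y assume "x \<in> states p m" "y \<in> {0..<int p}"
    thus "int p dvd G i k (x(i := y)) \<longleftrightarrow> int p dvd G i k x"
      using assms states_upd[of x p m i y] G_indep[of i "x(i := y)" x k] by auto
  next
    fix x assume x: "x \<in> states p m" "\<not> int p dvd G i k x"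
    obtain b where "\<And>y. y \<in> {0..<int p} \<Longrightarrow> [(T ^^ k) (x(i := y)) i = y * G i k x + b] (mod int p)"
      using Tpow_affine[OF x(1) assms] by blast
    hence "polyfun p 1 (G i k x) (\<lambda>y. (T ^^ k) (x(i := y)) i)"
      by (rule polyfun_cong[OF polyfun_linear])
    from card_zeros_polyfun[OF prime_p this x(2)]
    show "card {y \<in> {0..<int p}. int p dvd (T ^^ k) (x(i := y)) i} \<le> 1" .
  qed
  thus ?thesis by simp
qed

text \<open>
  The leading coefficient of \<open>G i k\<close> in \<open>x (i + 1)\<close>: each factor \<open>g i\<close> is evaluated at a point whose coordinate
  \<open>i + 1\<close> is itself affine in \<open>x (i + 1)\<close>, with slope \<open>G (i + 1) t\<close>.
\<close>
definition L :: "nat \<Rightarrow> nat \<Rightarrow> (nat \<Rightarrow> int) \<Rightarrow> int" where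
  "L i k x = (\<Prod>t<k. l i ((T ^^ t) x) * G (Suc i) t x ^ s i)"

lemma L_indep:
  assumes "i < m" "x \<in> states p m" "x' \<in> states p m" "\<And>j. j \<in> {Suc i<..m} \<Longrightarrow> x j = x' j"
  shows "L i k x = L i k x'"
proof -
  have "l i ((T ^^ t) x) = l i ((T ^^ t) x')" "G (Suc i) t x = G (Suc i) t x'" for t
    using assms Tpow_indep[of x x' "Suc i"] by (auto intro!: l_indep G_indep)
  thus ?thesis by (simp add: L_def)
qed

lemma G_polyfun:
  assumes "i < m" "x \<in> states p m"
  shows "polyfun p (k * s i) (L i k x) (\<lambda>y. G i k (x(Suc i := y)))"
proof -
  have "polyfun p (s i) (l i ((T ^^ t) x) * G (Suc i) t x ^ s i) (\<lambda>y. g i ((T ^^ t) (x(Suc i := y))))" for t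
  proof -
    let ?z = "(T ^^ t) x" and ?z' = "\<lambda>y. (T ^^ t) (x(Suc i := y))"
    obtain b where b: "\<And>y. y \<in> {0..<int p} \<Longrightarrow> [?z' y (Suc i) = y * G (Suc i) t x + b] (mod int p)"
      using Tpow_affine[OF assms(2) Suc_leI[OF assms(1)], of t] by blast
    have box: "x(Suc i := y) \<in> states p m" "?z' y \<in> states p m" if "y \<in> {0..<int p}" for y
      using assms that by (auto intro!: states_upd Tpow_in_states simp del: fun_upd_apply)
    have range: "?z' y (Suc i) \<in> {0..<int p}" if "y \<in> {0..<int p}" for y
      using states_mem[OF box(2)[OF that], of "Suc i"] assms(1) by auto
    have "polyfun p (s i) (l i ?z * G (Suc i) t x ^ s i) (\<lambda>y. g i (?z(Suc i := ?z' y (Suc i))))"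
      by (rule polyfun_compose_linear[OF g_polyfun[OF assms(1) Tpow_in_states[OF assms(2)]]])
         (use range b in blast)
    moreover have "g i (?z' y) = g i (?z(Suc i := ?z' y (Suc i)))" if "y \<in> {0..<int p}" for y
      using assms Tpow_indep[OF box(1)[OF that] assms(2), of "Suc i" _ t]
      by (intro g_indep) auto
    ultimately show ?thesis by (auto intro: polyfun_cong)
  qed
  from polyfun_prod[OF finite_lessThan[of k] this] show ?thesis by (simp add: G_def L_def)
qed

text \<open>
  The degrees \<open>k' * s i\<close> are strictly increasing in \<open>k'\<close>, so the last summand alone determines the leading
  coefficient. This is where \<open>s i > 0\<close> enters.
\<close>
lemma G_comb_polyfun:
  assumes "i < m" "x \<in> states p m"
  shows "polyfun p (k * s i) (c k * L i k x) (\<lambda>y. \<Sum>k'\<le>k. c k' * G i k' (x(Suc i := y)))"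
proof (induction k)
  case 0
  show ?case using polyfun_const[of p "c 0"] by (simp add: G_def L_def)
next
  case (Suc k)
  have "polyfun p (Suc k * s i) (c (Suc k) * L i (Suc k) x) (\<lambda>y. c (Suc k) * G i (Suc k) (x(Suc i := y)))"
    using polyfun_mult[OF polyfun_const[of p "c (Suc k)"] G_polyfun[OF assms, of "Suc k"]] by simp
  moreover have "k * s i < Suc k * s i" using s_pos[OF assms(1)] by simp
  ultimately show ?case by (subst sum.atMost_Suc) (rule polyfun_add_lower[OF _ Suc])
qed

lemma card_comb_zeros:
  assumes "i < m" "\<not> int p dvd c k"
  shows "card {x \<in> states p m. int p dvd (\<Sum>k'\<le>k. c k' * G i k' x)}
       \<le> card {x \<in> states p m. int p dvd L i k x} + k * s i * p ^ m"
proof (rule card_states_fiber_le[where i = "Suc i", OF p_pos])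
  show "Suc i \<le> m" using assms by simp
next
  fix x y assume "x \<in> states p m" "y \<in> {0..<int p}"
  thus "int p dvd L i k (x(Suc i := y)) \<longleftrightarrow> int p dvd L i k x"
    using assms states_upd[of x p m "Suc i" y] L_indep[of i "x(Suc i := y)" x k] by auto
next
  fix x assume x: "x \<in> states p m" "\<not> int p dvd L i k x"
  have "\<not> int p dvd c k * L i k x"
    using x assms prime_p by (simp add: prime_dvd_mult_iff)
  from card_zeros_polyfun[OF prime_p G_comb_polyfun[OF assms(1) x(1), where k = k and c = c] this]
  show "card {y \<in> {0..<int p}. int p dvd (\<Sum>k'\<le>k. c k' * G i k' (x(Suc i := y)))} \<le> k * s i" .
qed

lemma card_L_zeros:
  assumes "i < m"
  shows "card {x \<in> states p m. int p dvd L i k x} \<le>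
    (\<Sum>t<k. card {x \<in> states p m. int p dvd G (Suc i) t x}
        + (\<Sum>j\<in>{Suc i<..m}. card {x \<in> states p m. int p dvd G j t x} + p ^ m))"
proof -
  let ?Z = "\<lambda>\<phi>. {x \<in> states p m. int p dvd (\<phi> :: (nat \<Rightarrow> int) \<Rightarrow> int) x}"
  have "?Z (L i k) \<subseteq> (\<Union>t<k. ?Z (G (Suc i) t) \<union> (\<Union>j\<in>{Suc i<..m}. ?Z (\<lambda>x. (T ^^ t) x j)))"
  proof
    fix x assume x: "x \<in> ?Z (L i k)"
    then obtain t where t: "t < k" "int p dvd l i ((T ^^ t) x) * G (Suc i) t x ^ s i"
      using prime_p by (auto simp: L_def prime_dvd_prod_iff)
    have prime: "prime (int p)" using prime_p by simp
    have "int p dvd l i ((T ^^ t) x) \<or> int p dvd G (Suc i) t x ^ s i"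
      using prime t(2) by (simp only: prime_dvd_mult_iff)
    hence "int p dvd l i ((T ^^ t) x) \<or> int p dvd G (Suc i) t x"
      using prime_dvd_power[OF prime] by blast
    thus "x \<in> (\<Union>t<k. ?Z (G (Suc i) t) \<union> (\<Union>j\<in>{Suc i<..m}. ?Z (\<lambda>x. (T ^^ t) x j)))"
    proof
      assume "int p dvd l i ((T ^^ t) x)"
      then obtain j where "j \<in> {Suc i<..m}" "int p dvd (T ^^ t) x j"
        using l_nonzero[OF assms, of "(T ^^ t) x"] by metis
      thus ?thesis using t(1) x by blast
    next
      assume "int p dvd G (Suc i) t x"
      thus ?thesis using t(1) x by blast
    qed
  qed
  hence "card (?Z (L i k)) \<le> card (\<Union>t<k. ?Z (G (Suc i) t) \<union> (\<Union>j\<in>{Suc i<..m}. ?Z (\<lambda>x. (T ^^ t) x j)))"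
    using finite_states by (intro card_mono) auto
  also have "\<dots> \<le> (\<Sum>t<k. card (?Z (G (Suc i) t) \<union> (\<Union>j\<in>{Suc i<..m}. ?Z (\<lambda>x. (T ^^ t) x j))))"
    by (rule card_UN_le) auto
  also have "\<dots> \<le> (\<Sum>t<k. card (?Z (G (Suc i) t)) + (\<Sum>j\<in>{Suc i<..m}. card (?Z (\<lambda>x. (T ^^ t) x j))))"
    by (intro sum_mono order.trans[OF card_Un_le] add_left_mono card_UN_le) auto
  also have "\<dots> \<le> (\<Sum>t<k. card (?Z (G (Suc i) t)) + (\<Sum>j\<in>{Suc i<..m}. card (?Z (G j t)) + p ^ m))"
    by (intro sum_mono add_left_mono card_coordinate_zeros) auto
  finally show ?thesis .
qed

text \<open>
  Descending induction on \<open>i\<close>. The zeros of the leading coefficient lie among the zeros of at most \<open>k\<close> slopes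
  and coordinates for each later index, which are counted by the induction hypothesis; each step
  therefore costs one factor \<open>O(K)\<close>.
\<close>
lemma card_comb_zeros_le:
  assumes D: "\<And>i. i < m \<Longrightarrow> s i \<le> D"
  shows "i < m \<Longrightarrow> k < K \<Longrightarrow> \<not> int p dvd c k \<Longrightarrow>
    card {x \<in> states p m. int p dvd (\<Sum>k'\<le>k. c k' * G i k' x)} \<le> ((2 * m + D) * K) ^ (m - i) * p ^ m"
proof (induction "m - i" arbitrary: i k c rule: less_induct)
  case less
  define B where "B = (2 * m + D) * K"
  (* Q is the bound of the induction hypothesis at the next index, the worst one. *)
  define Q where "Q = B ^ (m - Suc i) * p ^ m"
  have "B \<ge> 1" using less.prems by (simp add: B_def)
  hence Q: "p ^ m \<le> Q" by (simp add: Q_def)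
  have Z: "card {x \<in> states p m. int p dvd G j t x} \<le> Q" if "j \<in> {i<..m}" "t < K" for j t
  proof (cases "j = m")
    case True
    hence "{x \<in> states p m. int p dvd G j t x} = {}" using G_top by simp
    thus ?thesis by (simp only: card.empty)
  next
    case False
    (* A single slope is the combination with one coefficient 1. *)
    define c' :: "nat \<Rightarrow> int" where "c' = (\<lambda>k. of_bool (k = t))"
    have "(\<Sum>k'\<le>t. c' k' * G j k' x) = G j t x" for x
    proof -
      have "(\<Sum>k'\<le>t. c' k' * G j k' x) = (\<Sum>k'\<le>t. if k' = t then G j k' x else 0)"
        by (intro sum.cong) (auto simp: c'_def)
      thus ?thesis by simp
    qed
    moreover have "\<not> int p dvd c' t" using prime_p not_prime_1 by (auto simp: c'_def)
    moreover have "m - j < m - i" using that False by auto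
    ultimately have "card {x \<in> states p m. int p dvd G j t x} \<le> B ^ (m - j) * p ^ m"
      using less.hyps[of j t c'] that False by (simp add: B_def)
    also have "\<dots> \<le> Q" unfolding Q_def
      using \<open>B \<ge> 1\<close> that by (intro mult_right_mono power_increasing) auto
    finally show ?thesis .
  qed
  have "card {x \<in> states p m. int p dvd L i k x} \<le> (\<Sum>t<k. Q + (\<Sum>j\<in>{Suc i<..m}. Q + Q))"
    by (rule order.trans[OF card_L_zeros[OF less.prems(1)]])
       (use less.prems Q in \<open>intro sum_mono add_mono Z; auto\<close>)
  also have "\<dots> = k * ((2 * (m - Suc i) + 1) * Q)" by (simp add: algebra_simps)
  also have "\<dots> \<le> K * ((2 * m) * Q)"
    using less.prems by (intro mult_le_mono) auto
  finally have "card {x \<in> states p m. int p dvd L i k x} \<le> K * (2 * m * Q)" .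
  moreover have "k * s i * p ^ m \<le> K * D * Q"
    using less.prems(2) D[OF less.prems(1)] Q by (intro mult_le_mono) auto
  ultimately have "card {x \<in> states p m. int p dvd (\<Sum>k'\<le>k. c k' * G i k' x)}
      \<le> K * (2 * m * Q) + K * D * Q"
    using card_comb_zeros[where c = c and k = k, OF less.prems(1,3)] by linarith
  also have "\<dots> = B * Q" by (simp add: B_def algebra_simps)
  also have "\<dots> = B ^ (m - i) * p ^ m"
  proof -
    have "m - i = Suc (m - Suc i)" using less.prems(1) by simp
    thus ?thesis by (simp only: Q_def power_Suc mult.assoc)
  qed
  finally show ?case by (simp add: B_def)
qed

text \<open>
  The exponent is affine in \<open>x i\<close>: earlier coordinates are absent because \<open>a j = 0\<close>, and later ones do not
  depend on \<open>x i\<close>. Summing over \<open>x i\<close> first gives \<open>p\<close> or \<open>0\<close>.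
\<close>
lemma norm_states_sum_le:
  assumes "i < m" "\<And>j. j < i \<Longrightarrow> a j = 0" "\<not> int p dvd a i"
  shows "norm (\<Sum>x\<in>states p m. ep p (\<Sum>k'\<le>k. c k' * (\<Sum>j<m. a j * (T ^^ k') x j)))
       \<le> card {x \<in> states p m. int p dvd (\<Sum>k'\<le>k. c k' * G i k' x)}"
proof -
  define E where "E = (\<lambda>x. \<Sum>k'\<le>k. c k' * (\<Sum>j<m. a j * (T ^^ k') x j))"
  define C where "C = (\<lambda>x. \<Sum>k'\<le>k. c k' * G i k' x)"
  have fiber: "norm (\<Sum>y\<in>{0..<int p}. ep p (E (x(i := y)))) = (if int p dvd C x then real p else 0)"
    if x: "x \<in> states p m" for x
  proof -
    have "\<exists>b. \<forall>k'. \<forall>y\<in>{0..<int p}. [(T ^^ k') (x(i := y)) i = y * G i k' x + b k'] (mod int p)"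
    proof (rule choice, rule allI)
      show "\<exists>b. \<forall>y\<in>{0..<int p}. [(T ^^ k') (x(i := y)) i = y * G i k' x + b] (mod int p)" for k'
        using assms(1) by (intro Tpow_affine[OF x]) simp
    qed
    then obtain b where b: "\<And>k' y. y \<in> {0..<int p} \<Longrightarrow> [(T ^^ k') (x(i := y)) i = y * G i k' x + b k'] (mod int p)"
      by blast
    define r where "r = (\<lambda>k'. \<Sum>j\<in>{i<..<m}. a j * (T ^^ k') x j)"
    define R where "R = (\<Sum>k'\<le>k. c k' * (a i * b k' + r k'))"
    have "[E (x(i := y)) = y * (a i * C x) + R] (mod int p)" if y: "y \<in> {0..<int p}" for y
    proof -
      have box: "x(i := y) \<in> states p m" using assms x y by (intro states_upd) auto
      have split: "(\<Sum>j<m. a j * (T ^^ k') (x(i := y)) j) = a i * (T ^^ k') (x(i := y)) i + r k'" for k'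
      proof -
        have "(\<Sum>j<m. a j * (T ^^ k') (x(i := y)) j) = (\<Sum>j\<in>insert i {i<..<m}. a j * (T ^^ k') (x(i := y)) j)"
          using assms(1,2) by (intro sum.mono_neutral_right) (auto simp del: fun_upd_apply)
        also have "\<dots> = a i * (T ^^ k') (x(i := y)) i + (\<Sum>j\<in>{i<..<m}. a j * (T ^^ k') (x(i := y)) j)"
          by (rule sum.insert) auto
        also have "(\<Sum>j\<in>{i<..<m}. a j * (T ^^ k') (x(i := y)) j) = r k'"
          unfolding r_def
          by (intro sum.cong refl arg_cong2[of _ _ _ _ "(*)"] Tpow_indep[OF box x, of i]) auto
        finally show ?thesis .
      qed
      have "[E (x(i := y)) = (\<Sum>k'\<le>k. c k' * (a i * (y * G i k' x + b k') + r k'))] (mod int p)"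
        unfolding E_def split using b[OF y] by (intro cong_sum cong_mult cong_add cong_refl) auto
      also have "(\<Sum>k'\<le>k. c k' * (a i * (y * G i k' x + b k') + r k')) = y * (a i * C x) + R"
        by (simp add: C_def R_def sum_distrib_left sum.distrib distrib_left mult_ac)
      finally show ?thesis .
    qed
    hence "(\<Sum>y\<in>{0..<int p}. ep p (E (x(i := y)))) = (\<Sum>y\<in>{0..<int p}. ep p (y * (a i * C x)) * ep p R)"
      using p_pos by (intro sum.cong) (auto simp del: fun_upd_apply simp flip: ep_add intro: ep_cong)
    also have "\<dots> = (\<Sum>y\<in>{0..<int p}. ep p (y * (a i * C x))) * ep p R"
      by (simp add: sum_distrib_right)
    finally show ?thesis
      using assms(3) prime_p by (simp add: sum_ep p_pos norm_mult prime_dvd_mult_iff)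
  qed
  have "real p * norm (\<Sum>x\<in>states p m. ep p (E x)) = norm (of_nat p * (\<Sum>x\<in>states p m. ep p (E x)))"
    by (simp add: norm_mult)
  also have "\<dots> = norm (\<Sum>x\<in>states p m. \<Sum>y\<in>{0..<int p}. ep p (E (x(i := y))))"
    using assms(1) by (subst sum_states_fiber) auto
  also have "\<dots> \<le> (\<Sum>x\<in>states p m. if int p dvd C x then real p else 0)"
    using fiber by (intro sum_norm_le) simp
  also have "\<dots> = real p * card {x \<in> states p m. int p dvd C x}"
    using finite_states by (simp add: sum.If_cases Int_def)
  finally show ?thesis using p_pos by (simp add: E_def C_def)
qed

end

section \<open>Evaluating polynomials over the field with p elements\<close>

lemma meval_superset:
  assumes "finite A" "Poly_Mapping.keys P \<subseteq> A"
  shows "meval P x = (\<Sum>t\<in>A. Poly_Mapping.lookup P t *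
     (\<Prod>j\<in>Poly_Mapping.keys t. x j ^ Poly_Mapping.lookup t j))"
  unfolding meval_def using assms by (intro sum.mono_neutral_left) (auto simp: in_keys_iff)

lemma monomial_superset:
  fixes x :: "nat \<Rightarrow> int"
  assumes "finite A" "Poly_Mapping.keys t \<subseteq> A"
  shows "(\<Prod>j\<in>Poly_Mapping.keys t. x j ^ Poly_Mapping.lookup t j) = (\<Prod>j\<in>A. x j ^ Poly_Mapping.lookup t j)"
  using assms by (intro prod.mono_neutral_left) (auto simp: in_keys_iff)

lemma monomial_add:
  fixes x :: "nat \<Rightarrow> int"
  shows "(\<Prod>j\<in>Poly_Mapping.keys (t + u). x j ^ Poly_Mapping.lookup (t + u) j)
      = (\<Prod>j\<in>Poly_Mapping.keys t. x j ^ Poly_Mapping.lookup t j)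
        * (\<Prod>j\<in>Poly_Mapping.keys u. x j ^ Poly_Mapping.lookup u j)"
proof -
  let ?A = "Poly_Mapping.keys t \<union> Poly_Mapping.keys u"
  have "Poly_Mapping.keys (t + u) \<subseteq> ?A" by (rule Poly_Mapping.keys_add)
  thus ?thesis
    using monomial_superset[of ?A "t + u" x] monomial_superset[of ?A t x] monomial_superset[of ?A u x]
    by (simp only: finite_UnI finite_keys Un_upper1 Un_upper2 lookup_add power_add prod.distrib)
qed

lemma meval_single:
  "meval (Poly_Mapping.single t c) x = c * (\<Prod>j\<in>Poly_Mapping.keys t. x j ^ Poly_Mapping.lookup t j)"
  by (subst meval_superset[of "{t}"]) auto

lemma meval_0 [simp]: "meval 0 x = 0"
  by (simp add: meval_def)

lemma meval_add: "meval (P + Q) x = meval P x + meval Q x"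
proof -
  let ?A = "Poly_Mapping.keys P \<union> Poly_Mapping.keys Q"
  have "Poly_Mapping.keys (P + Q) \<subseteq> ?A" by (rule Poly_Mapping.keys_add)
  thus ?thesis
    by (simp add: meval_superset[of ?A] lookup_add distrib_right sum.distrib)
qed

lemma meval_sum: "meval (\<Sum>a\<in>A. f a) x = (\<Sum>a\<in>A. meval (f a) x)"
  by (induction A rule: infinite_finite_induct) (simp_all add: meval_add)

lemma sum_singles: "P = (\<Sum>t\<in>Poly_Mapping.keys P. Poly_Mapping.single t (Poly_Mapping.lookup P t))"
proof (rule poly_mapping_eqI)
  fix t
  show "Poly_Mapping.lookup P t = Poly_Mapping.lookup (\<Sum>t\<in>Poly_Mapping.keys P. Poly_Mapping.single t (Poly_Mapping.lookup P t)) t"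
    by (auto simp: lookup_sum lookup_single when_def in_keys_iff)
qed

lemma meval_mult: "meval (P * Q) x = meval P x * meval Q x"
proof -
  have "P * Q = (\<Sum>t\<in>Poly_Mapping.keys P. Poly_Mapping.single t (Poly_Mapping.lookup P t))
      * (\<Sum>u\<in>Poly_Mapping.keys Q. Poly_Mapping.single u (Poly_Mapping.lookup Q u))"
    by (rule arg_cong2[of _ _ _ _ "(*)"]) (rule sum_singles)+
  also have "\<dots> = (\<Sum>t\<in>Poly_Mapping.keys P. \<Sum>u\<in>Poly_Mapping.keys Q.
      Poly_Mapping.single (t + u) (Poly_Mapping.lookup P t * Poly_Mapping.lookup Q u))"
    by (simp add: sum_product mult_single)
  finally show ?thesis
    by (simp add: meval_sum meval_single monomial_add) (simp add: meval_def sum_product mult_ac)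
qed

lemma meval_mConst [simp]: "meval (mConst c) x = c"
  by (simp add: mConst_def meval_single)

lemma meval_1 [simp]: "meval 1 x = 1"
  using meval_single[of 0 1 x] by simp

lemma meval_mVar [simp]: "meval (mVar i) x = x i"
  by (simp add: mVar_def meval_single)

lemma meval_power: "meval (P ^ n) x = meval P x ^ n"
  by (induction n) (simp_all add: meval_mult)

lemma meval_prod: "meval (\<Prod>a\<in>A. f a) x = (\<Prod>a\<in>A. meval (f a) x)"
  by (induction A rule: infinite_finite_induct) (simp_all add: meval_mult)

lemma meval_Fp_eq:
  assumes "Fp_eq p P Q"
  shows "[meval P x = meval Q x] (mod int p)"
proof -
  let ?A = "Poly_Mapping.keys P \<union> Poly_Mapping.keys Q"
  show ?thesis using assms
    by (subst (1 2) meval_superset[of ?A]) (auto simp: Fp_eq_def intro!: cong_sum cong_mult)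
qed

lemma meval_indep:
  assumes "P \<in> Fp_polys p I" "\<And>j. j \<in> I \<Longrightarrow> x j = x' j"
  shows "meval P x = meval P x'"
proof -
  have "x j = x' j" if "t \<in> Poly_Mapping.keys P" "j \<in> Poly_Mapping.keys t" for t j
    using assms that unfolding Fp_polys_def by blast
  thus ?thesis unfolding meval_def by (intro sum.cong prod.cong arg_cong2[of _ _ _ _ "(*)"]) auto
qed

lemma mdegree_in_lessD:
  assumes "mdegree_in j P < ereal (real n)" "t \<in> Poly_Mapping.keys P"
  shows "Poly_Mapping.lookup t j < n"
proof -
  have "ereal (real (Poly_Mapping.lookup t j)) \<le> mdegree_in j P"
    unfolding mdegree_in_def by (rule SUP_upper[OF assms(2)])
  also note assms(1)
  finally show ?thesis by simp
qed

text \<open>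
  A degree bound in one variable, read as a statement about the function obtained by fixing all
  other variables.
\<close>
lemma polyfun_meval_lower:
  assumes "mdegree_in i P < ereal (real (Suc n))"
  shows "\<exists>l. polyfun p n l (\<lambda>y. meval P (x(i := y)))"
proof -
  define Q where "Q = (\<Sum>t\<in>Poly_Mapping.keys P. monom (Poly_Mapping.lookup P t *
      (\<Prod>j\<in>Poly_Mapping.keys t - {i}. x j ^ Poly_Mapping.lookup t j)) (Poly_Mapping.lookup t i))"
  have "degree Q \<le> n"
    unfolding Q_def
    using mdegree_in_lessD[OF assms]
    by (intro degree_sum_le finite_keys order.trans[OF degree_monom_le]) (auto simp: less_Suc_eq_le)
  moreover have "meval P (x(i := y)) = poly Q y" for y
  proof -
    have "(\<Prod>j\<in>Poly_Mapping.keys t. (x(i := y)) j ^ Poly_Mapping.lookup t j)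
        = y ^ Poly_Mapping.lookup t i * (\<Prod>j\<in>Poly_Mapping.keys t - {i}. x j ^ Poly_Mapping.lookup t j)" for t
    proof -
      have "(\<Prod>j\<in>Poly_Mapping.keys t. (x(i := y)) j ^ Poly_Mapping.lookup t j)
          = (\<Prod>j\<in>insert i (Poly_Mapping.keys t - {i}). (x(i := y)) j ^ Poly_Mapping.lookup t j)"
        by (rule monomial_superset) auto
      also have "\<dots> = y ^ Poly_Mapping.lookup t i
          * (\<Prod>j\<in>Poly_Mapping.keys t - {i}. (x(i := y)) j ^ Poly_Mapping.lookup t j)"
        by (subst prod.insert) auto
      also have "(\<Prod>j\<in>Poly_Mapping.keys t - {i}. (x(i := y)) j ^ Poly_Mapping.lookup t j)
          = (\<Prod>j\<in>Poly_Mapping.keys t - {i}. x j ^ Poly_Mapping.lookup t j)"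
        by (intro prod.cong) auto
      finally show ?thesis .
    qed
    thus ?thesis by (simp only: meval_def Q_def poly_sum poly_monom) (simp add: mult_ac)
  qed
  ultimately show ?thesis unfolding polyfun_def by auto
qed

lemma lookup_single_mult_shift:
  fixes P :: mpoly
  shows "Poly_Mapping.lookup (Poly_Mapping.single u 1 * P) (u + t) = Poly_Mapping.lookup P t"
proof -
  have "Poly_Mapping.single u 1 * P = (\<Sum>v\<in>Poly_Mapping.keys P. Poly_Mapping.single (u + v) (Poly_Mapping.lookup P v))"
  proof -
    have "Poly_Mapping.single u 1 * P = Poly_Mapping.single u 1
        * (\<Sum>v\<in>Poly_Mapping.keys P. Poly_Mapping.single v (Poly_Mapping.lookup P v))"
      by (rule arg_cong[OF sum_singles])
    thus ?thesis by (simp add: sum_distrib_left mult_single)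
  qed
  thus ?thesis by (auto simp: lookup_sum lookup_single when_def in_keys_iff)
qed

lemma prod_mVar_power:
  "finite A \<Longrightarrow> (\<Prod>j\<in>A. mVar j ^ e j) = Poly_Mapping.single (\<Sum>j\<in>A. Poly_Mapping.single j (e j)) 1"
proof (induction A rule: finite_induct)
  case (insert a A)
  have "mVar j ^ n = Poly_Mapping.single (Poly_Mapping.single j n) 1" for j n
    by (induction n) (simp_all add: mVar_def mult_single flip: single_add)
  thus ?case using insert by (simp add: mult_single)
qed simp

text \<open>
  The monomial \<open>x\<^sub>i \<Prod>x\<^sub>j\<^bsup>e j\<^esup>\<close> cannot cancel in \<open>F i\<close>: the lower-order part has smaller degree in
  \<open>x (i + 1)\<close> and \<open>H\<close> does not contain \<open>x i\<close>. Hence the exponents, and with them the implied constant, are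
  controlled by the degree of the system.
\<close>
lemma exponent_le_degree:
  assumes p: "prime p"
    and "F i \<in> Fp_polys p {..m}" and "i < m"
    and H: "H \<in> Fp_polys p {i+1..m}"
    and c: "c \<in> {1..<int p}"
    and F: "Fp_eq p (F i) (mVar i * G + H)"
    and G: "Fp_eq p G (mConst c * (\<Prod>j\<in>{i+1..m}. mVar j ^ e j) + G')"
    and G': "mdegree_in (i + 1) G' < ereal (real (e (i + 1)))"
    and d: "system_degree m F = ereal (real d)"
  shows "e (i + 1) \<le> d"
proof -
  define t1 where "t1 = (\<Sum>j\<in>{i+1..m}. Poly_Mapping.single j (e j))"
  define t0 where "t0 = Poly_Mapping.single i 1 + t1"
  have lookup_t1: "Poly_Mapping.lookup t1 j = (if j \<in> {i+1..m} then e j else 0)" for j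
    by (simp add: t1_def lookup_sum lookup_single when_def)
  have t1: "Poly_Mapping.lookup t1 (i + 1) = e (i + 1)" "Poly_Mapping.lookup t1 i = 0"
    using \<open>i < m\<close> by (simp_all add: lookup_t1)
  have "t0 \<notin> Poly_Mapping.keys H"
  proof
    assume "t0 \<in> Poly_Mapping.keys H"
    hence "Poly_Mapping.keys t0 \<subseteq> {i+1..m}" using H by (auto simp: Fp_polys_def)
    moreover have "i \<in> Poly_Mapping.keys t0" using t1 by (simp add: t0_def in_keys_iff lookup_add)
    ultimately show False by auto
  qed
  hence H0: "Poly_Mapping.lookup H t0 = 0" by (simp add: in_keys_iff)
  have G0: "Poly_Mapping.lookup G' t1 = 0"
    using mdegree_in_lessD[OF G', of t1] t1 by (auto simp: in_keys_iff)
  have "[Poly_Mapping.lookup (F i) t0 = Poly_Mapping.lookup (mVar i * G + H) t0] (mod int p)"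
    using F by (simp add: Fp_eq_def)
  also have "Poly_Mapping.lookup (mVar i * G + H) t0 = Poly_Mapping.lookup G t1"
    using H0 by (simp add: lookup_add t0_def mVar_def lookup_single_mult_shift)
  also have "[Poly_Mapping.lookup G t1
      = Poly_Mapping.lookup (mConst c * (\<Prod>j\<in>{i+1..m}. mVar j ^ e j) + G') t1] (mod int p)"
    using G by (simp add: Fp_eq_def)
  also have "Poly_Mapping.lookup (mConst c * (\<Prod>j\<in>{i+1..m}. mVar j ^ e j) + G') t1 = c"
    using G0 by (subst prod_mVar_power) (simp_all add: lookup_add mConst_def mult_single t1_def)
  finally have "[Poly_Mapping.lookup (F i) t0 = c] (mod int p)" .
  moreover have "\<not> int p dvd c" using c zdvd_not_zless[of c "int p"] by auto
  ultimately have "Poly_Mapping.lookup (F i) t0 \<noteq> 0" by (auto simp: cong_dvd_iff cong_0_iff dest: cong_sym)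
  hence t0: "t0 \<in> Poly_Mapping.keys (F i)" by (simp add: in_keys_iff)
  have "e (i + 1) \<le> (\<Sum>j\<in>Poly_Mapping.keys t0. Poly_Mapping.lookup t0 j)"
  proof (cases "i + 1 \<in> Poly_Mapping.keys t0")
    case True
    have "Poly_Mapping.lookup t0 (i + 1) \<le> (\<Sum>j\<in>Poly_Mapping.keys t0. Poly_Mapping.lookup t0 j)"
      using True by (intro member_le_sum) auto
    thus ?thesis using t1 by (simp add: t0_def lookup_add lookup_single)
  next
    case False
    thus ?thesis using t1 by (simp add: t0_def lookup_add in_keys_iff lookup_single)
  qed
  hence "ereal (real (e (i + 1))) \<le> ereal (real (\<Sum>j\<in>Poly_Mapping.keys t0. Poly_Mapping.lookup t0 j))"
    by (simp del: of_nat_sum)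
  also have "\<dots> \<le> mdegree (F i)"
    unfolding mdegree_def by (rule SUP_upper[OF t0])
  also have "\<dots> \<le> system_degree m F"
    unfolding system_degree_def using \<open>i < m\<close> by (intro SUP_upper) auto
  finally show ?thesis using d by simp
qed

text \<open>
  The leading coefficient \<open>l i\<close> is the monomial \<open>c i * \<Prod>x\<^sub>j\<close> in the variables after \<open>i + 1\<close>, with the
  exponents of row \<open>i\<close> of \<open>S\<close>. The last component, of degree one, is treated as having the constant
  slope \<open>g\<^sub>m\<close> and the constant offset \<open>h\<^sub>m\<close>.
\<close>
lemma triangular_system_map:
  assumes p: "prime p"
    and S: "(\<Prod>i<m. S $$ (i, i + 1)) \<noteq> 0"
    and F: "F \<in> triangular_systems p m S"
    and d: "system_degree m F = ereal (real d)"
  obtains g h l where "triangular_map p m (\<lambda>i. S $$ (i, i + 1)) (\<lambda>i. meval (F i)) g h l"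
    and "\<And>i. i < m \<Longrightarrow> S $$ (i, i + 1) \<le> d"
proof -
  have "\<forall>i. \<exists>G H G' c. i < m \<longrightarrow>
        G \<in> Fp_polys p {i+1..m} \<and> H \<in> Fp_polys p {i+1..m} \<and>
        c \<in> {1..<int p} \<and> Fp_eq p (F i) (mVar i * G + H) \<and>
        Fp_eq p G (mConst c * (\<Prod>j\<in>{i+1..m}. mVar j ^ (S $$ (i, j))) + G') \<and>
        mdegree_in (i + 1) G' < ereal (real (S $$ (i, i + 1)))"
    (is "\<forall>i. \<exists>G H G' c. ?P i G H G' c")
  proof
    fix i
    show "\<exists>G H G' c. ?P i G H G' c"
    proof (cases "i < m")
      case True
      with F obtain G H G' c where "G \<in> Fp_polys p {i+1..m}" "H \<in> Fp_polys p {i+1..m}"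
        "c \<in> {1..<int p}" "Fp_eq p (F i) (mVar i * G + H)"
        "Fp_eq p G (mConst c * (\<Prod>j\<in>{i+1..m}. mVar j ^ (S $$ (i, j))) + G')"
        "\<forall>j\<in>{i+1..m}. mdegree_in j G' < ereal (real (S $$ (i, j)))"
        unfolding triangular_systems_def by blast
      thus ?thesis using True by (intro exI[of _ G] exI[of _ H] exI[of _ G'] exI[of _ c]) auto
    qed blast
  qed
  hence "\<exists>G H G' c. \<forall>i. ?P i (G i) (H i) (G' i) (c i)"
    by (simp only: choice_iff)
  then obtain G H G' c where GH: "\<And>i. ?P i (G i) (H i) (G' i) (c i)"
    by blast
  from F obtain g\<^sub>m h\<^sub>m where top: "g\<^sub>m \<in> {1..<int p}" "Fp_eq p (F m) (mConst g\<^sub>m * mVar m + mConst h\<^sub>m)"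
    unfolding triangular_systems_def by blast
  have unit: "\<not> int p dvd a" if "a \<in> {1..<int p}" for a
    using that zdvd_not_zless[of a "int p"] by auto
  define g where "g = (\<lambda>i x. if i < m then meval (G i) x else g\<^sub>m)"
  define h where "h = (\<lambda>i x. if i < m then meval (H i) x else h\<^sub>m)"
  define l where "l = (\<lambda>i x. c i * (\<Prod>j\<in>{Suc i<..m}. x j ^ (S $$ (i, j))) :: int)"
  have pos: "S $$ (i, i + 1) > 0" if "i < m" for i
    using S that by auto
  have "triangular_map p m (\<lambda>i. S $$ (i, i + 1)) (\<lambda>i. meval (F i)) g h l"
  proof
    show "prime p" by fact
    show "S $$ (i, i + 1) > 0" if "i < m" for i using pos that .
    show "[meval (F i) x = x i * g i x + h i x] (mod int p)" if "i \<le> m" for i x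
    proof (cases "i < m")
      case True
      thus ?thesis using GH[of i] meval_Fp_eq[of p "F i" "mVar i * G i + H i" x]
        by (simp add: meval_add meval_mult g_def h_def)
    next
      case False
      hence "i = m" using that by simp
      thus ?thesis using meval_Fp_eq[OF top(2), of x]
        by (simp add: meval_add meval_mult g_def h_def mult.commute)
    qed
    show "g i x = g i x'" if "\<And>j. j \<in> {i<..m} \<Longrightarrow> x j = x' j" for i x x'
      using GH[of i] that by (auto simp: g_def intro: meval_indep)
    show "h i x = h i x'" if "\<And>j. j \<in> {i<..m} \<Longrightarrow> x j = x' j" for i x x'
      using GH[of i] that by (auto simp: h_def intro: meval_indep)
    show "l i x = l i x'" if "\<And>j. j \<in> {Suc i<..m} \<Longrightarrow> x j = x' j" for i x x'
      using that by (simp add: l_def)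
    show "\<not> int p dvd g m x" for x using unit[OF top(1)] by (simp add: g_def)
    show "\<not> int p dvd l i x" if "i < m" "\<And>j. j \<in> {Suc i<..m} \<Longrightarrow> \<not> int p dvd x j" for i x
    proof -
      have prime: "prime (int p)" using p by simp
      have "\<not> int p dvd x j ^ n" if "j \<in> {Suc i<..m}" for j n
        using prime_dvd_power[OF prime] \<open>\<And>j. j \<in> {Suc i<..m} \<Longrightarrow> \<not> int p dvd x j\<close> that by blast
      moreover have "\<not> int p dvd c i" using unit GH \<open>i < m\<close> by blast
      ultimately show ?thesis using prime
        by (auto simp: l_def prime_dvd_mult_iff prime_dvd_prod_iff)
    qed
    show "polyfun p (S $$ (i, i + 1)) (l i x) (\<lambda>y. g i (x(Suc i := y)))" if "i < m" for i x
    proof -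
      let ?s = "S $$ (i, i + 1)"
      note GHi = GH[of i, rule_format, OF that]
      have "?s > 0" by (rule pos) fact
      then obtain n where n: "?s = Suc n" using gr0_implies_Suc by blast
      obtain l' where l': "polyfun p n l' (\<lambda>y. meval (G' i) (x(Suc i := y)))"
        using polyfun_meval_lower[of "Suc i" "G' i" n p x] GHi n by auto
      have "polyfun p ?s (l i x) (\<lambda>y. l i x * y ^ ?s)"
        unfolding polyfun_def
        by (rule exI[of _ "monom (l i x) ?s"]) (simp add: degree_monom_le poly_monom)
      from polyfun_add_lower[OF this l'] n
      have "polyfun p ?s (l i x) (\<lambda>y. meval (G' i) (x(Suc i := y)) + l i x * y ^ ?s)" by simp
      moreover have "[g i (x(Suc i := y)) = meval (G' i) (x(Suc i := y)) + l i x * y ^ ?s] (mod int p)" for y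
      proof -
        have "{i+1..m} = insert (Suc i) {Suc i<..m}" using that by auto
        hence "(\<Prod>j\<in>{i+1..m}. (x(Suc i := y)) j ^ (S $$ (i, j)))
            = y ^ ?s * (\<Prod>j\<in>{Suc i<..m}. (x(Suc i := y)) j ^ (S $$ (i, j)))"
          by simp
        also have "(\<Prod>j\<in>{Suc i<..m}. (x(Suc i := y)) j ^ (S $$ (i, j))) = (\<Prod>j\<in>{Suc i<..m}. x j ^ (S $$ (i, j)))"
          by (intro prod.cong) auto
        finally have eq: "(\<Prod>j\<in>{i+1..m}. (x(Suc i := y)) j ^ (S $$ (i, j)))
            = y ^ ?s * (\<Prod>j\<in>{Suc i<..m}. x j ^ (S $$ (i, j)))" .
        have "[meval (G i) (x(Suc i := y)) = meval (mConst (c i) * (\<Prod>j\<in>{i+1..m}. mVar j ^ (S $$ (i, j))) + G' i)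
              (x(Suc i := y))] (mod int p)"
          using GHi by (intro meval_Fp_eq) simp
        also have "meval (mConst (c i) * (\<Prod>j\<in>{i+1..m}. mVar j ^ (S $$ (i, j))) + G' i) (x(Suc i := y))
            = meval (G' i) (x(Suc i := y)) + l i x * y ^ ?s"
          unfolding meval_add meval_mult meval_prod meval_power meval_mVar meval_mConst eq l_def
          by (simp add: algebra_simps)
        finally show ?thesis using that unfolding g_def by (simp only: if_True)
      qed
      ultimately show ?thesis by (rule polyfun_cong)
    qed
  qed
  moreover have "S $$ (i, i + 1) \<le> d" if "i < m" for i
  proof (rule exponent_le_degree[where e = "\<lambda>j. S $$ (i, j)"])
    note GHi = GH[of i, rule_format, OF that]
    show "prime p" "i < m" "system_degree m F = ereal (real d)" by fact+
    show "F i \<in> Fp_polys p {..m}" using F that unfolding triangular_systems_def by simp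
    show "H i \<in> Fp_polys p {i+1..m}" "c i \<in> {1..<int p}" "Fp_eq p (F i) (mVar i * G i + H i)"
      "Fp_eq p (G i) (mConst (c i) * (\<Prod>j\<in>{i+1..m}. mVar j ^ (S $$ (i, j))) + G' i)"
      "mdegree_in (i + 1) (G' i) < ereal (real (S $$ (i, i + 1)))"
      using GHi by blast+
  qed
  ultimately show ?thesis by (rule that)
qed

section \<open>Moments of shifted sums\<close>

lemma sum_comp_eq_sum_card:
  fixes \<phi> :: "nat \<Rightarrow> int" and \<kappa> :: "nat \<Rightarrow> nat"
  assumes "\<kappa> \<in> {..<\<nu>} \<rightarrow>\<^sub>E {..<K}"
  shows "(\<Sum>j<\<nu>. \<phi> (\<kappa> j)) = (\<Sum>k<K. int (card {j \<in> {..<\<nu>}. \<kappa> j = k}) * \<phi> k)"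
proof -
  have "(\<Sum>j<\<nu>. \<phi> (\<kappa> j)) = (\<Sum>k<K. \<Sum>j\<in>{j \<in> {..<\<nu>}. \<kappa> j = k}. \<phi> (\<kappa> j))"
    using assms by (intro sum.group [symmetric]) auto
  also have "\<dots> = (\<Sum>k<K. \<Sum>j\<in>{j \<in> {..<\<nu>}. \<kappa> j = k}. \<phi> k)"
    by (intro sum.cong) auto
  finally show ?thesis by simp
qed

lemma norm_power_even_expand:
  fixes \<phi> :: "nat \<Rightarrow> int"
  shows "of_real (norm (\<Sum>k<K. ep p (\<phi> k)) ^ (2 * \<nu>)) =
    (\<Sum>\<kappa>\<in>{..<\<nu>} \<rightarrow>\<^sub>E {..<K}. \<Sum>\<mu>\<in>{..<\<nu>} \<rightarrow>\<^sub>E {..<K}. ep p ((\<Sum>j<\<nu>. \<phi> (\<kappa> j)) - (\<Sum>j<\<nu>. \<phi> (\<mu> j))))"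
proof -
  let ?z = "\<Sum>k<K. ep p (\<phi> k)" and ?I = "{..<\<nu>} \<rightarrow>\<^sub>E {..<K}"
  have expand: "?z ^ \<nu> = (\<Sum>\<kappa>\<in>?I. ep p (\<Sum>j<\<nu>. \<phi> (\<kappa> j)))"
  proof -
    have "?z ^ \<nu> = (\<Prod>j<\<nu>. ?z)" by simp
    also have "\<dots> = (\<Sum>\<kappa>\<in>?I. \<Prod>j<\<nu>. ep p (\<phi> (\<kappa> j)))"
      by (rule prod_sum_PiE) auto
    finally show ?thesis by (simp add: ep_sum)
  qed
  have "of_real (norm ?z ^ (2 * \<nu>)) = (?z * cnj ?z) ^ \<nu>"
    by (simp add: complex_norm_square [symmetric] power_mult del: cnj_sum)
  also have "\<dots> = ?z ^ \<nu> * cnj (?z ^ \<nu>)"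
    by (simp add: power_mult_distrib del: cnj_sum)
  also have "\<dots> = (\<Sum>\<kappa>\<in>?I. \<Sum>\<mu>\<in>?I. ep p (\<Sum>j<\<nu>. \<phi> (\<kappa> j)) * ep p (- (\<Sum>j<\<nu>. \<phi> (\<mu> j))))"
    unfolding expand by (simp add: sum_product ep_minus)
  finally show ?thesis by (simp flip: ep_add)
qed

text \<open>
  Shifting the range of summation by \<open>k\<close> changes at most \<open>2 k\<close> terms of norm at most \<open>1\<close>.
\<close>
lemma shift_average:
  fixes f :: "nat \<Rightarrow> complex"
  assumes "\<And>n. norm (f n) \<le> 1"
  shows "real K * norm (\<Sum>n<N. f n) \<le> (\<Sum>n<N. norm (\<Sum>k<K. f (n + k))) + real K * (2 * real K)"
proof -
  have shift: "norm ((\<Sum>n<N. f n) - (\<Sum>n<N. f (n + k))) \<le> 2 * real k" for k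
  proof (induction k)
    case (Suc k)
    have "(\<Sum>n<N. f (n + k)) - (\<Sum>n<N. f (n + Suc k)) = f k - f (N + k)"
      by (induction N) (simp_all add: add.commute)
    hence "(\<Sum>n<N. f n) - (\<Sum>n<N. f (n + Suc k)) = ((\<Sum>n<N. f n) - (\<Sum>n<N. f (n + k))) + (f k - f (N + k))"
      by (simp add: algebra_simps)
    also have "norm \<dots> \<le> norm ((\<Sum>n<N. f n) - (\<Sum>n<N. f (n + k))) + norm (f k - f (N + k))"
      by (rule norm_triangle_ineq)
    also have "norm (f k - f (N + k)) \<le> 1 + 1"
      using assms by (intro order.trans[OF norm_triangle_ineq4] add_mono)
    finally show ?case using Suc by simp
  qed simp
  have "real K * norm (\<Sum>n<N. f n) = norm (\<Sum>k<K. \<Sum>n<N. f n)"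
    by (simp add: norm_mult)
  also have "(\<Sum>k<K. \<Sum>n<N. f n)
      = (\<Sum>k<K. \<Sum>n<N. f (n + k)) + (\<Sum>k<K. (\<Sum>n<N. f n) - (\<Sum>n<N. f (n + k)))"
    by (simp flip: sum.distrib)
  also have "norm \<dots> \<le> norm (\<Sum>k<K. \<Sum>n<N. f (n + k)) + (\<Sum>k<K. 2 * real K)"
    by (intro norm_triangle_mono order.refl sum_norm_le order.trans[OF shift]) auto
  also have "(\<Sum>k<K. \<Sum>n<N. f (n + k)) = (\<Sum>n<N. \<Sum>k<K. f (n + k))"
    by (rule sum.swap)
  also have "norm \<dots> \<le> (\<Sum>n<N. norm (\<Sum>k<K. f (n + k)))"
    by (rule norm_sum)
  finally show ?thesis by simp
qed

text \<open>
  Jensen's inequality for an even power.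
\<close>
lemma power_mean_even:
  fixes r :: "nat \<Rightarrow> real"
  assumes "even M" "M > 0"
  shows "(\<Sum>n<N. r n) ^ M \<le> real N ^ (M - 1) * (\<Sum>n<N. r n ^ M)"
proof (cases "N = 0")
  case True
  thus ?thesis using assms by (simp add: power_0_left)
next
  case False
  have "(\<Sum>n<N. (1 / real N) *\<^sub>R r n) ^ M \<le> (\<Sum>n<N. (1 / real N) * r n ^ M)"
    using False assms by (intro convex_on_sum[OF _ _ convex_power_even]) auto
  hence "(\<Sum>n<N. r n) ^ M / real N ^ M \<le> (\<Sum>n<N. r n ^ M) / real N"
    by (simp add: power_divide flip: sum_divide_distrib)
  hence "(\<Sum>n<N. r n) ^ M \<le> (\<Sum>n<N. r n ^ M) / real N * real N ^ M"
    using False by (simp add: divide_le_eq)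
  also have "real N ^ M = real N * real N ^ (M - 1)"
    using assms by (simp add: power_eq_if)
  finally show ?thesis using False by (simp add: mult_ac)
qed

context triangular_map
begin

text \<open>
  The number \<open>k\<close> of steps and the starting point \<open>x\<close> are separate arguments because shifting an orbit
  is the same as restarting it: \<open>\<Phi> a (n + k) w = \<Phi> a k ((T ^^ n) w)\<close>.
\<close>
definition \<Phi> :: "(nat \<Rightarrow> int) \<Rightarrow> nat \<Rightarrow> (nat \<Rightarrow> int) \<Rightarrow> int" where
  "\<Phi> a k x = (\<Sum>j<m. a j * (T ^^ k) x j)"

text \<open>
  The zero count applies to combinations whose top coefficient is nonzero modulo \<open>p\<close>; terms above the
  last such coefficient do not change the character.
\<close>
lemma norm_comb_sum_le:
  assumes a: "i < m" "\<And>j. j < i \<Longrightarrow> a j = 0" "\<not> int p dvd a i"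
    and D: "\<And>i. i < m \<Longrightarrow> s i \<le> D"
    and c: "\<exists>k<K. \<not> int p dvd c k"
  shows "norm (\<Sum>x\<in>states p m. ep p (\<Sum>k<K. c k * \<Phi> a k x)) \<le> ((2 * m + D) * K) ^ m * p ^ m"
proof -
  define U where "U = {k \<in> {..<K}. \<not> int p dvd c k}"
  define k where "k = Max U"
  have U: "finite U" "U \<noteq> {}" using c by (auto simp: U_def)
  have k: "k < K" "\<not> int p dvd c k"
    using Max_in[OF U] by (auto simp: k_def U_def)
  have above: "int p dvd c k'" if "k' \<in> {..<K} - {..k}" for k'
  proof (rule ccontr)
    assume "\<not> int p dvd c k'"
    hence "k' \<le> k" unfolding k_def using that U by (intro Max_ge) (auto simp: U_def)
    thus False using that by simp
  qed
  have "ep p (\<Sum>k'<K. c k' * \<Phi> a k' x) = ep p (\<Sum>k'\<le>k. c k' * \<Phi> a k' x)" for x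
  proof (rule ep_cong[OF p_pos])
    have "(\<Sum>k'<K. c k' * \<Phi> a k' x)
        = (\<Sum>k'\<in>{..<K} - {..k}. c k' * \<Phi> a k' x) + (\<Sum>k'\<le>k. c k' * \<Phi> a k' x)"
      using k by (intro sum.subset_diff) auto
    moreover have "int p dvd (\<Sum>k'\<in>{..<K} - {..k}. c k' * \<Phi> a k' x)"
      using above by (intro dvd_sum dvd_mult2) auto
    ultimately show "[(\<Sum>k'<K. c k' * \<Phi> a k' x) = (\<Sum>k'\<le>k. c k' * \<Phi> a k' x)] (mod int p)"
      by (simp add: cong_iff_dvd_diff)
  qed
  hence "norm (\<Sum>x\<in>states p m. ep p (\<Sum>k<K. c k * \<Phi> a k x))
      \<le> card {x \<in> states p m. int p dvd (\<Sum>k'\<le>k. c k' * G i k' x)}"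
    using norm_states_sum_le[where i = i and a = a and c = c and k = k, OF a] by (simp add: \<Phi>_def)
  also have "card {x \<in> states p m. int p dvd (\<Sum>k'\<le>k. c k' * G i k' x)} \<le> ((2 * m + D) * K) ^ (m - i) * p ^ m"
    using card_comb_zeros_le[where c = c and k = k, OF D a(1) k] by simp
  also have "((2 * m + D) * K) ^ (m - i) * p ^ m \<le> ((2 * m + D) * K) ^ m * p ^ m"
    using k a(1) by (intro mult_right_mono power_increasing) auto
  finally show ?thesis by simp
qed

text \<open>
  For a pair of tuples \<open>\<kappa>\<close>, \<open>\<mu>\<close> the coefficient of \<open>k\<close> is the difference of its multiplicities. If some value of \<open>\<mu>\<close>
  is missing from \<open>\<kappa>\<close>, its coefficient lies between \<open>- \<nu>\<close> and \<open>- 1\<close> and is nonzero modulo \<open>p > \<nu>\<close>. All other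
  pairs, at most \<open>\<nu>\<^sup>\<nu>\<close> for each \<open>\<kappa>\<close>, are estimated trivially.
\<close>
lemma moment_le:
  assumes a: "i < m" "\<And>j. j < i \<Longrightarrow> a j = 0" "\<not> int p dvd a i"
    and D: "\<And>i. i < m \<Longrightarrow> s i \<le> D"
    and \<nu>: "\<nu> < p"
  shows "(\<Sum>x\<in>states p m. norm (\<Sum>k<K. ep p (\<Phi> a k x)) ^ (2 * \<nu>))
    \<le> real (\<nu> ^ \<nu> * K ^ \<nu> * p ^ (m + 1) + K ^ (2 * \<nu>) * (((2 * m + D) * K) ^ m * p ^ m))"
proof -
  define I where "I = {..<\<nu>} \<rightarrow>\<^sub>E {..<K}"
  define Q where "Q = ((2 * m + D) * K) ^ m * p ^ m"
  define E where "E = (\<lambda>\<kappa> \<mu>. \<Sum>x\<in>states p m. ep p ((\<Sum>j<\<nu>. \<Phi> a (\<kappa> j) x) - (\<Sum>j<\<nu>. \<Phi> a (\<mu> j) x)))"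
  have finI: "finite I" unfolding I_def by (intro finite_PiE) auto
  have cardI: "card I = K ^ \<nu>" by (simp add: I_def card_PiE)
  have E_le: "norm (E \<kappa> \<mu>) \<le> real p ^ (m + 1) * of_bool (\<mu> \<in> {..<\<nu>} \<rightarrow>\<^sub>E \<kappa> ` {..<\<nu>}) + real Q"
    if I: "\<kappa> \<in> I" "\<mu> \<in> I" for \<kappa> \<mu>
  proof (cases "\<mu> \<in> {..<\<nu>} \<rightarrow>\<^sub>E \<kappa> ` {..<\<nu>}")
    case True
    have "norm (E \<kappa> \<mu>) \<le> (\<Sum>x\<in>states p m. 1)"
      unfolding E_def by (intro sum_norm_le) simp
    thus ?thesis using True by (simp add: card_states)
  next
    case False
    define c where "c = (\<lambda>k. int (card {j \<in> {..<\<nu>}. \<kappa> j = k}) - int (card {j \<in> {..<\<nu>}. \<mu> j = k}))"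
    obtain j where j: "j < \<nu>" "\<mu> j \<notin> \<kappa> ` {..<\<nu>}"
      using False I(2) by (auto simp: I_def PiE_iff)
    let ?n = "card {j' \<in> {..<\<nu>}. \<mu> j' = \<mu> j}"
    have "{j' \<in> {..<\<nu>}. \<kappa> j' = \<mu> j} = {}" using j(2) by force
    hence c: "c (\<mu> j) = - int ?n" by (simp only: c_def card.empty)
    have "?n > 0" using j(1) by (auto simp: card_gt_0_iff)
    moreover have "?n \<le> \<nu>" using card_mono[of "{..<\<nu>}" "{j' \<in> {..<\<nu>}. \<mu> j' = \<mu> j}"] by auto
    ultimately have "\<not> int p dvd c (\<mu> j)"
      unfolding c using \<nu> by (auto dest!: dvd_imp_le)
    moreover have "\<mu> j < K" using I(2) j(1) by (auto simp: I_def)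
    ultimately have "norm (\<Sum>x\<in>states p m. ep p (\<Sum>k<K. c k * \<Phi> a k x)) \<le> Q"
      unfolding Q_def by (intro norm_comb_sum_le[where i = i and a = a, OF a D]) auto
    moreover have "E \<kappa> \<mu> = (\<Sum>x\<in>states p m. ep p (\<Sum>k<K. c k * \<Phi> a k x))"
      unfolding E_def
    proof (intro sum.cong refl arg_cong[of _ _ "ep p"])
      fix x
      show "(\<Sum>j<\<nu>. \<Phi> a (\<kappa> j) x) - (\<Sum>j<\<nu>. \<Phi> a (\<mu> j) x) = (\<Sum>k<K. c k * \<Phi> a k x)"
        using sum_comp_eq_sum_card[OF I(1)[unfolded I_def], of "\<lambda>k. \<Phi> a k x"]
          sum_comp_eq_sum_card[OF I(2)[unfolded I_def], of "\<lambda>k. \<Phi> a k x"]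
        by (simp add: c_def left_diff_distrib sum_subtractf)
    qed
    ultimately show ?thesis using False by simp
  qed
  have "(\<Sum>x\<in>states p m. norm (\<Sum>k<K. ep p (\<Phi> a k x)) ^ (2 * \<nu>))
      = norm (of_real (\<Sum>x\<in>states p m. norm (\<Sum>k<K. ep p (\<Phi> a k x)) ^ (2 * \<nu>)) :: complex)"
    unfolding norm_of_real by (rule abs_of_nonneg [symmetric]) (simp add: sum_nonneg)
  also have "complex_of_real (\<Sum>x\<in>states p m. norm (\<Sum>k<K. ep p (\<Phi> a k x)) ^ (2 * \<nu>))
      = (\<Sum>x\<in>states p m. \<Sum>\<kappa>\<in>I. \<Sum>\<mu>\<in>I. ep p ((\<Sum>j<\<nu>. \<Phi> a (\<kappa> j) x) - (\<Sum>j<\<nu>. \<Phi> a (\<mu> j) x)))"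
    unfolding of_real_sum norm_power_even_expand I_def ..
  also have "\<dots> = (\<Sum>\<kappa>\<in>I. \<Sum>x\<in>states p m. \<Sum>\<mu>\<in>I. ep p ((\<Sum>j<\<nu>. \<Phi> a (\<kappa> j) x) - (\<Sum>j<\<nu>. \<Phi> a (\<mu> j) x)))"
    by (rule sum.swap)
  also have "\<dots> = (\<Sum>\<kappa>\<in>I. \<Sum>\<mu>\<in>I. E \<kappa> \<mu>)"
    unfolding E_def by (intro sum.cong refl sum.swap)
  also have "norm \<dots> \<le> (\<Sum>\<kappa>\<in>I. \<Sum>\<mu>\<in>I. real p ^ (m + 1) * of_bool (\<mu> \<in> {..<\<nu>} \<rightarrow>\<^sub>E \<kappa> ` {..<\<nu>}) + real Q)"
    by (intro sum_norm_le E_le)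
  also have "\<dots> \<le> (\<Sum>\<kappa>\<in>I. real p ^ (m + 1) * real (\<nu> ^ \<nu>) + real (card I) * real Q)"
  proof (rule sum_mono)
    fix \<kappa> assume "\<kappa> \<in> I"
    have "(\<Sum>\<mu>\<in>I. of_bool (\<mu> \<in> {..<\<nu>} \<rightarrow>\<^sub>E \<kappa> ` {..<\<nu>}) :: real) = card (I \<inter> ({..<\<nu>} \<rightarrow>\<^sub>E \<kappa> ` {..<\<nu>}))"
      using finI by (simp add: sum_of_bool_eq)
    also have "card (I \<inter> ({..<\<nu>} \<rightarrow>\<^sub>E \<kappa> ` {..<\<nu>})) \<le> card ({..<\<nu>} \<rightarrow>\<^sub>E \<kappa> ` {..<\<nu>})"
      by (intro card_mono finite_PiE) auto
    also have "\<dots> = card (\<kappa> ` {..<\<nu>}) ^ \<nu>" by (simp add: card_PiE)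
    also have "\<dots> \<le> \<nu> ^ \<nu>"
      using card_image_le[of "{..<\<nu>}" \<kappa>] by (intro power_mono) auto
    finally have "(\<Sum>\<mu>\<in>I. of_bool (\<mu> \<in> {..<\<nu>} \<rightarrow>\<^sub>E \<kappa> ` {..<\<nu>}) :: real) \<le> real (\<nu> ^ \<nu>)"
      by simp
    thus "(\<Sum>\<mu>\<in>I. real p ^ (m + 1) * of_bool (\<mu> \<in> {..<\<nu>} \<rightarrow>\<^sub>E \<kappa> ` {..<\<nu>}) + real Q)
        \<le> real p ^ (m + 1) * real (\<nu> ^ \<nu>) + real (card I) * real Q"
      unfolding sum.distrib sum_constant sum_distrib_left [symmetric]
      by (intro add_mono mult_left_mono) auto
  qed
  also have "\<dots> = real (\<nu> ^ \<nu> * K ^ \<nu> * p ^ (m + 1) + K ^ (2 * \<nu>) * Q)"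
    unfolding sum_constant cardI mult_2 power_add by (simp add: algebra_simps)
  finally show ?thesis by (simp only: Q_def)
qed

text \<open>
  Distinctness of the points of the orbit lets the sum over the orbit be extended to all states.
\<close>
lemma norm_orbit_sum_power_le:
  assumes a: "i < m" "\<And>j. j < i \<Longrightarrow> a j = 0" "\<not> int p dvd a i"
    and D: "\<And>i. i < m \<Longrightarrow> s i \<le> D"
    and \<nu>: "0 < \<nu>" "\<nu> < p" and K: "0 < K"
    and w: "w \<in> states p m" "inj_on (\<lambda>n. (T ^^ n) w) {..<N}"
  obtains W where "norm (\<Sum>n<N. ep p (\<Phi> a n w)) \<le> W / real K + 2 * real K" and "0 \<le> W"
    and "W ^ (2 * \<nu>) \<le> real N ^ (2 * \<nu> - 1) *
       real (\<nu> ^ \<nu> * K ^ \<nu> * p ^ (m + 1) + K ^ (2 * \<nu>) * (((2 * m + D) * K) ^ m * p ^ m))"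
proof
  define W where "W = (\<Sum>n<N. norm (\<Sum>k<K. ep p (\<Phi> a (n + k) w)))"
  show "0 \<le> W" by (simp add: W_def sum_nonneg)
  have "real K * norm (\<Sum>n<N. ep p (\<Phi> a n w)) \<le> W + real K * (2 * real K)"
    unfolding W_def by (rule shift_average) simp
  thus "norm (\<Sum>n<N. ep p (\<Phi> a n w)) \<le> W / real K + 2 * real K"
    using K by (simp add: field_simps)
  define \<psi> where "\<psi> = (\<lambda>x. norm (\<Sum>k<K. ep p (\<Phi> a k x)) ^ (2 * \<nu>))"
  have "W ^ (2 * \<nu>) \<le> real N ^ (2 * \<nu> - 1) * (\<Sum>n<N. norm (\<Sum>k<K. ep p (\<Phi> a (n + k) w)) ^ (2 * \<nu>))"
    unfolding W_def using \<nu> by (intro power_mean_even) auto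
  also have "(\<Sum>n<N. norm (\<Sum>k<K. ep p (\<Phi> a (n + k) w)) ^ (2 * \<nu>)) = (\<Sum>n<N. \<psi> ((T ^^ n) w))"
  proof -
    have "\<Phi> a (n + k) w = \<Phi> a k ((T ^^ n) w)" for n k
      by (simp add: \<Phi>_def add.commute[of n] funpow_add)
    thus ?thesis by (simp add: \<psi>_def)
  qed
  also have "\<dots> = (\<Sum>x\<in>(\<lambda>n. (T ^^ n) w) ` {..<N}. \<psi> x)"
    using w(2) by (simp add: sum.reindex)
  also have "\<dots> \<le> (\<Sum>x\<in>states p m. \<psi> x)"
    using w(1) by (intro sum_mono2 finite_states) (auto simp: Tpow_in_states \<psi>_def)
  also have "\<dots> \<le> real (\<nu> ^ \<nu> * K ^ \<nu> * p ^ (m + 1) + K ^ (2 * \<nu>) * (((2 * m + D) * K) ^ m * p ^ m))"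
    unfolding \<psi>_def by (rule moment_le[where i = i and a = a, OF a D \<nu>(2)])
  finally show "W ^ (2 * \<nu>) \<le> real N ^ (2 * \<nu> - 1) *
       real (\<nu> ^ \<nu> * K ^ \<nu> * p ^ (m + 1) + K ^ (2 * \<nu>) * (((2 * m + D) * K) ^ m * p ^ m))"
    by (simp add: mult_left_mono)
qed

end

section \<open>The bound for orbits\<close>

text \<open>
  A repetition within one period would, by determinism, make the distance of the two positions a
  smaller period.
\<close>
lemma purely_periodic_inj_on:
  assumes "purely_periodic w \<tau>" and step: "\<And>n. w (Suc n) = \<phi> (w n)"
  shows "inj_on w {..<\<tau>}"
proof -
  have per: "\<tau> > 0" "\<And>n. w (n + \<tau>) = w n"
    and least: "\<And>t. 0 < t \<Longrightarrow> (\<And>n. w (n + t) = w n) \<Longrightarrow> \<tau> \<le> t"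
    using assms(1) by (auto simp: purely_periodic_def)
  have pow: "w (k + n) = (\<phi> ^^ k) (w n)" for k n
    by (induction k) (simp_all add: step)
  have False if ab: "a < b" "b < \<tau>" "w a = w b" for a b
  proof -
    have "w (n + (b - a)) = w n" for n
    proof -
      (* One period is added so that the shift by b - a starts after position a. *)
      have "w (n + (b - a)) = w ((n + (\<tau> - a)) + b)"
        using per(2)[of "n + (b - a)"] ab by (simp add: algebra_simps)
      also have "\<dots> = w ((n + (\<tau> - a)) + a)"
        unfolding pow using ab(3) by simp
      also have "\<dots> = w n" using per(2)[of n] ab by (simp add: algebra_simps)
      finally show ?thesis .
    qed
    hence "\<tau> \<le> b - a" using ab by (intro least) auto
    thus False using ab by simp
  qed
  thus ?thesis unfolding inj_on_def by (metis lessThan_iff nat_neq_iff)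
qed

text \<open>
  For an orbit of maximal length \<open>N = p\<^sup>m\<^sup>+\<^sup>1\<close> this is the exponent of \<open>p\<close> in \<open>p\<^sup>\<alpha> / N\<^sup>\<beta>\<close>.
\<close>
lemma exponent_difference:
  fixes m \<nu> :: nat
  assumes "\<nu> > 0"
  shows "real (m\<^sup>2 + m * \<nu> + m) / real (2 * \<nu> * (m + \<nu>)) - (real m + 1) * (1 / (2 * real \<nu>))
    = - (1 / (2 * (real m + real \<nu>)))"
proof -
  define M v where "M = real m" and "v = real \<nu>"
  have pos: "v > 0" "M + v > 0" using assms by (simp_all add: M_def v_def)
  have "(M + 1) * (1 / (2 * v)) = (M + 1) * (M + v) / (2 * v * (M + v))"
    using pos by simp
  moreover have "1 / (2 * (M + v)) = v / (2 * v * (M + v))"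
    using pos by simp
  ultimately have "(M\<^sup>2 + M * v + M) / (2 * v * (M + v)) - (M + 1) * (1 / (2 * v)) = - (1 / (2 * (M + v)))"
    by (simp only: diff_divide_distrib [symmetric] minus_divide_left) (simp add: power2_eq_square algebra_simps)
  thus ?thesis by (simp add: M_def v_def)
qed

lemma exponent_ge:
  fixes m \<nu> :: nat
  assumes "\<nu> > 0" "m > 0"
  shows "1 / (2 * real \<nu>) \<le> real (m\<^sup>2 + m * \<nu> + m) / real (2 * \<nu> * (m + \<nu>))"
proof -
  have "m + \<nu> \<le> m * (m + \<nu> + 1)"
    using assms mult_le_mono1[of 1 m "m + \<nu> + 1"] by simp
  hence "m + \<nu> \<le> m\<^sup>2 + m * \<nu> + m" by (simp add: power2_eq_square algebra_simps)
  hence "real (m + \<nu>) \<le> real (m\<^sup>2 + m * \<nu> + m)" by (rule of_nat_mono)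
  hence "real (m + \<nu>) / real (2 * \<nu> * (m + \<nu>)) \<le> real (m\<^sup>2 + m * \<nu> + m) / real (2 * \<nu> * (m + \<nu>))"
    by (rule divide_right_mono) simp
  moreover have "real (m + \<nu>) / real (2 * \<nu> * (m + \<nu>)) = 1 / (2 * real \<nu>)"
    using assms by simp
  ultimately show ?thesis by simp
qed

text \<open>
  The right-hand side decreases in \<open>N\<close>, and at \<open>N = p\<^sup>m\<^sup>+\<^sup>1\<close> its exponent is \<open>-1 / (2 (m + \<nu>))\<close>. The
  estimate absorbs the discretisation error \<open>m / p\<close> and makes the final bound trivial for bounded \<open>p\<close>.
\<close>
lemma inverse_le_bound:
  fixes m \<nu> N p :: nat
  defines "\<alpha> \<equiv> real (m\<^sup>2 + m * \<nu> + m) / real (2 * \<nu> * (m + \<nu>))"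
    and "\<beta> \<equiv> 1 / (2 * real \<nu>)"
  assumes \<nu>: "\<nu> > 0" and "p > 0" and N: "0 < N" "N \<le> p ^ (m + 1)"
  shows "1 / real p \<le> real p powr \<alpha> * real N powr (- \<beta>)"
proof -
  note \<alpha> = exponent_difference[OF \<nu>, of m, folded \<alpha>_def \<beta>_def]
  have "1 / real p = real p powr (- 1)" using \<open>p > 0\<close> by (simp add: powr_minus divide_inverse)
  also have "real p powr (- 1) \<le> real p powr (\<alpha> - (real m + 1) * \<beta>)"
    unfolding \<alpha>(1) using \<open>p > 0\<close> \<nu> by (intro powr_mono) (auto simp: field_simps)
  also have "\<dots> = real p powr \<alpha> * (real p powr (real m + 1)) powr (- \<beta>)"
    by (simp add: powr_powr flip: powr_add)
  also have "real p powr (real m + 1) = real (p ^ (m + 1))"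
    using powr_realpow[of "real p" "m + 1"] \<open>p > 0\<close> by (simp add: add.commute)
  also have "real p powr \<alpha> * real (p ^ (m + 1)) powr (- \<beta>) \<le> real p powr \<alpha> * real N powr (- \<beta>)"
  proof (intro mult_left_mono powr_mono2')
    show "real N \<le> real (p ^ (m + 1))" using N(2) by (rule of_nat_mono)
  qed (use N in \<open>auto simp: \<beta>_def\<close>)
  finally show ?thesis .
qed

context triangular_map
begin

text \<open>
  If \<open>p \<le> \<nu>\<close> or \<open>N < p\<close>, the trivial bound \<open>N\<close> suffices. Otherwise \<open>K\<close> is the \<open>(m + \<nu>)\<close>-th root of
  \<open>p\<close>, rounded up: this balances the diagonal and the off-diagonal part of the moment. The shifts cost
  \<open>2 K\<close>, which the bound dominates since \<open>K \<le> 2 \<surd>p \<le> 2 \<surd>N\<close>.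
\<close>
lemma norm_orbit_sum_le:
  fixes D \<nu> N :: nat
  defines "\<alpha> \<equiv> real (m\<^sup>2 + m * \<nu> + m) / real (2 * \<nu> * (m + \<nu>))"
    and "\<beta> \<equiv> 1 / (2 * real \<nu>)"
  assumes a: "i < m" "\<And>j. j < i \<Longrightarrow> a j = 0" "\<not> int p dvd a i"
    and D: "\<And>i. i < m \<Longrightarrow> s i \<le> D"
    and \<nu>: "0 < \<nu>" and N: "0 < N" "N \<le> p ^ (m + 1)"
    and w: "w \<in> states p m" "inj_on (\<lambda>n. (T ^^ n) w) {..<N}"
  shows "norm (\<Sum>n<N. ep p (\<Phi> a n w))
    \<le> real (\<nu> ^ \<nu> + (2 * m + D) ^ m * 2 ^ (m + \<nu>) + 4 + \<nu>) * (real p powr \<alpha> * real N powr (1 - \<beta>))"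
proof -
  define V where "V = real p powr \<alpha> * real N powr (1 - \<beta>)"
  define C1 where "C1 = real (\<nu> ^ \<nu> + (2 * m + D) ^ m * 2 ^ (m + \<nu>))"
  let ?S = "norm (\<Sum>n<N. ep p (\<Phi> a n w))"
  have p1: "real p \<ge> 1" using p_pos by simp
  have N1: "real N \<ge> 1" using N by simp
  have m: "m > 0" using a(1) by simp
  have V0: "V > 0" using p_pos N by (simp add: V_def)
  have trivial: "?S \<le> N"
    by (rule order.trans[OF norm_sum]) simp
  have \<beta>: "0 < \<beta>" "\<beta> \<le> 1 / 2" using \<nu> by (auto simp: \<beta>_def field_simps)
  note \<alpha> = exponent_difference[OF \<nu>, of m, folded \<alpha>_def \<beta>_def]
    exponent_ge[OF \<nu> m, folded \<alpha>_def \<beta>_def]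
  have C1: "C1 \<ge> 1"
  proof -
    have "1 \<le> \<nu> ^ \<nu>" using \<nu> by (intro one_le_power) simp
    hence "1 \<le> \<nu> ^ \<nu> + (2 * m + D) ^ m * 2 ^ (m + \<nu>)" by (rule trans_le_add1)
    hence "real 1 \<le> C1" unfolding C1_def by (rule of_nat_mono)
    thus ?thesis by (simp only: of_nat_1)
  qed
  consider "p \<le> \<nu>" | "N < p" | "\<nu> < p" "p \<le> N" by linarith
  hence "?S \<le> (C1 + 4 + \<nu>) * V"
  proof cases
    case 1
    have "1 / real p \<le> real p powr \<alpha> * real N powr (- \<beta>)"
      unfolding \<alpha>_def \<beta>_def by (rule inverse_le_bound[OF \<nu> p_pos N])
    also have "real N powr (- \<beta>) = real N powr (1 - \<beta>) / real N"
      using N by (simp add: powr_diff powr_minus divide_inverse)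
    finally have "real N \<le> real p * V"
      using p_pos N by (simp add: V_def field_simps)
    also have "\<dots> \<le> \<nu> * V" using 1 V0 by (intro mult_right_mono) auto
    also have "\<dots> \<le> (C1 + 4 + \<nu>) * V" using V0 C1 by (intro mult_right_mono) auto
    finally show ?thesis using trivial by simp
  next
    case 2
    have "real N = real N powr \<beta> * real N powr (1 - \<beta>)"
      using N by (simp flip: powr_add)
    also have "\<dots> \<le> real p powr \<alpha> * real N powr (1 - \<beta>)"
    proof (rule mult_right_mono)
      have "real N powr \<beta> \<le> real p powr \<beta>" using 2 \<beta> by (intro powr_mono2) auto
      also have "\<dots> \<le> real p powr \<alpha>" using \<alpha>(2) p1 by (intro powr_mono) auto
      finally show "real N powr \<beta> \<le> real p powr \<alpha>" .
    qed simp
    also have "\<dots> = 1 * V" by (simp add: V_def)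
    also have "\<dots> \<le> (C1 + 4 + \<nu>) * V" using V0 C1 by (intro mult_right_mono) auto
    finally show ?thesis using trivial by simp
  next
    case 3
    define \<kappa> where "\<kappa> = real p powr (1 / real (m + \<nu>))"
    define K where "K = nat \<lceil>\<kappa>\<rceil>"
    have \<kappa>1: "\<kappa> \<ge> 1" unfolding \<kappa>_def using p1 by (intro ge_one_powr_ge_zero) auto
    have K: "\<kappa> \<le> real K" "real K \<le> 2 * \<kappa>"
      using \<kappa>1 unfolding K_def by linarith+
    hence K0: "K > 0" using \<kappa>1 by (intro Nat.gr0I) auto
    have \<kappa>p: "\<kappa> ^ (m + \<nu>) = real p"
      using p_pos \<nu> by (simp add: \<kappa>_def powr_realpow [symmetric] powr_powr)
    obtain W where W: "?S \<le> W / real K + 2 * real K" "0 \<le> W"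
      "W ^ (2 * \<nu>) \<le> real N ^ (2 * \<nu> - 1) *
        real (\<nu> ^ \<nu> * K ^ \<nu> * p ^ (m + 1) + K ^ (2 * \<nu>) * (((2 * m + D) * K) ^ m * p ^ m))"
      by (rule norm_orbit_sum_power_le[where i = i and a = a, OF a D \<nu> 3(1) K0 w])
    have "real (K ^ (2 * \<nu>) * (((2 * m + D) * K) ^ m * p ^ m))
        = real ((2 * m + D) ^ m) * real K ^ \<nu> * real K ^ (m + \<nu>) * real p ^ m"
      unfolding mult_2[of \<nu>] power_add by (simp add: power_mult_distrib power_add)
    also have "\<dots> \<le> real ((2 * m + D) ^ m) * real K ^ \<nu> * (2 ^ (m + \<nu>) * real p) * real p ^ m"
    proof -
      have "real K ^ (m + \<nu>) \<le> (2 * \<kappa>) ^ (m + \<nu>)" using K by (intro power_mono) auto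
      also have "\<dots> = 2 ^ (m + \<nu>) * real p" by (simp only: power_mult_distrib \<kappa>p)
      finally show ?thesis by (intro mult_right_mono mult_left_mono) auto
    qed
    finally have "real (\<nu> ^ \<nu> * K ^ \<nu> * p ^ (m + 1) + K ^ (2 * \<nu>) * (((2 * m + D) * K) ^ m * p ^ m))
        \<le> C1 * real K ^ \<nu> * real p ^ (m + 1)"
      by (simp add: C1_def algebra_simps)
    hence "W ^ (2 * \<nu>) \<le> real N ^ (2 * \<nu> - 1) * (C1 * real K ^ \<nu> * real p ^ (m + 1))"
      using W(3) by (meson mult_left_mono order.trans of_nat_0_le_iff zero_le_power)
    also have "real p ^ (m + 1) = real p powr (2 * real \<nu> * \<alpha>) * \<kappa> ^ \<nu>"
    proof -
      have "real m + 1 = 2 * real \<nu> * \<alpha> + 1 / real (m + \<nu>) * real \<nu>"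
      proof -
        have "\<alpha> = (real m + 1) * \<beta> - 1 / (2 * (real m + real \<nu>))" using \<alpha>(1) by linarith
        hence "2 * real \<nu> * \<alpha> = 2 * real \<nu> * ((real m + 1) * \<beta>) - 2 * real \<nu> * (1 / (2 * (real m + real \<nu>)))"
          by (simp only: right_diff_distrib)
        moreover have "2 * real \<nu> * ((real m + 1) * \<beta>) = real m + 1" using \<nu> by (simp add: \<beta>_def)
        moreover have "2 * real \<nu> * (1 / (2 * u)) = 1 / u * real \<nu>" for u by simp
        ultimately show ?thesis by (simp only: of_nat_add)
      qed
      hence "real p powr (real m + 1) = real p powr (2 * real \<nu> * \<alpha>) * \<kappa> powr real \<nu>"
        by (simp only: powr_add \<kappa>_def powr_powr)
      moreover have "\<kappa> powr real \<nu> = \<kappa> ^ \<nu>" using \<kappa>1 by (intro powr_realpow) simp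
      moreover have "real p powr (real m + 1) = real p ^ (m + 1)"
        using powr_realpow[of "real p" "m + 1"] p_pos by (simp add: add.commute)
      ultimately show ?thesis by simp
    qed
    also have "real N ^ (2 * \<nu> - 1) * (C1 * real K ^ \<nu> * (real p powr (2 * real \<nu> * \<alpha>) * \<kappa> ^ \<nu>))
        \<le> real N ^ (2 * \<nu> - 1) * (C1 * real K ^ \<nu> * (real p powr (2 * real \<nu> * \<alpha>) * real K ^ \<nu>))"
      using C1 K \<kappa>1 by (intro mult_left_mono power_mono) auto
    also have "\<dots> = C1 * (V * real K) ^ (2 * \<nu>)"
    proof -
      have "(real p powr \<alpha>) ^ (2 * \<nu>) = real p powr (2 * real \<nu> * \<alpha>)"
        using p_pos by (simp add: powr_realpow [symmetric] powr_powr mult.commute)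
      moreover have "(real N powr (1 - \<beta>)) ^ (2 * \<nu>) = real N ^ (2 * \<nu> - 1)"
      proof -
        have "(real N powr (1 - \<beta>)) ^ (2 * \<nu>) = real N powr ((1 - \<beta>) * real (2 * \<nu>))"
          using N by (simp add: powr_realpow [symmetric] powr_powr)
        also have "(1 - \<beta>) * real (2 * \<nu>) = real (2 * \<nu> - 1)"
          using \<nu> by (simp add: \<beta>_def field_simps of_nat_diff)
        finally show ?thesis using N by (simp only: powr_realpow of_nat_0_less_iff)
      qed
      moreover have "real K ^ \<nu> * real K ^ \<nu> = real K ^ (2 * \<nu>)"
        by (simp only: mult_2 power_add)
      ultimately show ?thesis
        by (simp add: V_def power_mult_distrib)
    qed
    also have "\<dots> \<le> C1 ^ (2 * \<nu>) * (V * real K) ^ (2 * \<nu>)"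
      using C1 V0 \<nu> by (intro mult_right_mono self_le_power) auto
    also have "\<dots> = (C1 * (V * real K)) ^ (2 * \<nu>)"
      by (simp only: power_mult_distrib)
    finally have "W \<le> C1 * (V * real K)"
      using C1 V0 \<nu> W(2) by (subst (asm) power_mono_iff) auto
    hence "W / real K \<le> C1 * V" using K0 by (simp add: divide_le_eq mult.assoc)
    moreover have "\<kappa> \<le> V"
    proof -
      have "\<kappa> \<le> real p powr (1 / 2)"
        unfolding \<kappa>_def using p1 m \<nu> by (intro powr_mono) (auto simp: field_simps)
      also have "\<dots> \<le> real N powr (1 / 2)" using 3 by (intro powr_mono2) auto
      also have "\<dots> \<le> real N powr (1 - \<beta>)" using \<beta> N1 by (intro powr_mono) auto
      also have "\<dots> = 1 * real N powr (1 - \<beta>)" by simp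
      also have "\<dots> \<le> V"
      proof -
        have "1 \<le> real p powr \<alpha>" using p1 \<alpha>(2) \<beta> by (intro ge_one_powr_ge_zero) auto
        thus ?thesis unfolding V_def by (rule mult_right_mono) simp
      qed
      finally show ?thesis .
    qed
    ultimately have "?S \<le> C1 * V + 4 * V" using W(1) K by linarith
    also have "\<dots> \<le> (C1 + 4 + \<nu>) * V" using V0 by (simp add: algebra_simps)
    finally show ?thesis .
  qed
  thus ?thesis by (simp add: C1_def V_def)
qed

text \<open>
  The index \<open>i\<close> to which the exponential sum bound is applied is the first one at which the frequency
  \<open>a\<close> does not vanish.
\<close>
lemma discrepancy_orbit_le:
  fixes D \<nu> N :: nat
  defines "\<alpha> \<equiv> real (m\<^sup>2 + m * \<nu> + m) / real (2 * \<nu> * (m + \<nu>))"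
    and "\<beta> \<equiv> 1 / (2 * real \<nu>)"
    and "C1 \<equiv> real (\<nu> ^ \<nu> + (2 * m + D) ^ m * 2 ^ (m + \<nu>) + 4 + \<nu>)"
  assumes D: "\<And>i. i < m \<Longrightarrow> s i \<le> D"
    and m: "0 < m" and \<nu>: "0 < \<nu>" and N: "0 < N"
    and w: "w \<in> states p m" "inj_on (\<lambda>n. (T ^^ n) w) {..<N}"
  shows "discrepancy m N (\<lambda>n i. real_of_int ((T ^^ n) w i) / real p)
    \<le> (real m * 2 ^ m + C1 * 4 ^ m) * (real p powr \<alpha> * real N powr (- \<beta>) * ln (real p) ^ m)"
proof -
  define R where "R = real p powr \<alpha> * real N powr (- \<beta>)"
  have p2: "p \<ge> 2" using prime_p by (rule prime_ge_2_nat)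
  have "card ((\<lambda>n. (T ^^ n) w) ` {..<N}) \<le> card (states p m)"
    using w(1) by (intro card_mono finite_states) (auto intro: Tpow_in_states)
  hence Np: "N \<le> p ^ (m + 1)"
    using w(2) by (simp add: card_image card_states)
  have V: "real p powr \<alpha> * real N powr (1 - \<beta>) = real N * R"
    using N by (simp add: R_def powr_diff powr_minus divide_inverse)
  have R0: "R \<ge> 0" by (simp add: R_def)
  have C1: "C1 \<ge> 0" by (simp add: C1_def)
  have sum_le: "norm (\<Sum>n<N. ep p (\<Sum>j<m. a j * (T ^^ n) w j)) \<le> C1 * (real N * R)"
    if a: "a \<in> {..<m} \<rightarrow>\<^sub>E {0..<int p}" "\<exists>j<m. a j \<noteq> 0" for a
  proof -
    define i where "i = (LEAST j. j < m \<and> a j \<noteq> 0)"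
    have i: "i < m" "a i \<noteq> 0"
      using LeastI_ex[of "\<lambda>j. j < m \<and> a j \<noteq> 0", folded i_def] a(2) by blast+
    have zero: "a j = 0" if "j < i" for j
      using not_less_Least[of j "\<lambda>j. j < m \<and> a j \<noteq> 0", folded i_def, OF that] that i(1) by simp
    have "a i \<in> {0..<int p}" using PiE_mem[OF a(1), of i] i(1) by simp
    hence "\<not> int p dvd a i" using i(2) zdvd_not_zless[of "a i" "int p"] by simp
    from norm_orbit_sum_le[where i = i and a = a, OF i(1) zero this D \<nu> N Np w]
    have "norm (\<Sum>n<N. ep p (\<Phi> a n w)) \<le> C1 * (real p powr \<alpha> * real N powr (1 - \<beta>))"
      unfolding \<alpha>_def \<beta>_def C1_def .
    thus ?thesis by (simp only: \<Phi>_def V)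
  qed
  have range: "(T ^^ n) w i \<in> {0..<int p}" if "i < m" for n i
    using states_mem[OF Tpow_in_states[OF w(1)], of i n] that by simp
  have "discrepancy m N (\<lambda>n i. real_of_int ((T ^^ n) w i) / real p)
      \<le> real m / real p + C1 * (real N * R) / real N * (2 + ln (real p)) ^ m"
  proof (rule discrepancy_le[OF p2 N])
    show "0 \<le> C1 * (real N * R)" using C1 R0 by simp
  qed (assumption | rule range sum_le)+
  hence disc: "discrepancy m N (\<lambda>n i. real_of_int ((T ^^ n) w i) / real p)
      \<le> real m / real p + C1 * R * (2 + ln (real p)) ^ m" using N by simp
  have inv: "real m / real p \<le> real m * R"
  proof -
    have "1 / real p \<le> R"
      unfolding R_def \<alpha>_def \<beta>_def by (rule inverse_le_bound[OF \<nu> p_pos N Np])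
    from mult_left_mono[OF this, of "real m"] show ?thesis by simp
  qed
  (* Since ln p is bounded below, constants can be absorbed into powers of 2 ln p and 4 ln p. *)
  have ln2: "2 / 3 \<le> ln (real p)"
    proof -
    have "ln 2 \<le> ln (real p)" using p2 by (intro ln_mono) auto
    thus ?thesis using ln2_ge_two_thirds by linarith
  qed
  have "real m * R \<le> real m * R * (2 * ln (real p)) ^ m"
    using mult_left_mono[OF one_le_power[of "2 * ln (real p)" m], of "real m * R"] ln2 R0 by simp
  moreover have "C1 * R * (2 + ln (real p)) ^ m \<le> C1 * R * (4 * ln (real p)) ^ m"
    using ln2 R0 C1 by (intro mult_left_mono power_mono) auto
  ultimately have "discrepancy m N (\<lambda>n i. real_of_int ((T ^^ n) w i) / real p)
      \<le> real m * R * (2 * ln (real p)) ^ m + C1 * R * (4 * ln (real p)) ^ m"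
    using disc inv by linarith
  also have "\<dots> = (real m * 2 ^ m + C1 * 4 ^ m) * (R * ln (real p) ^ m)"
    by (simp add: power_mult_distrib algebra_simps)
  finally show ?thesis by (simp add: R_def)
qed

end

theorem corollary5:
  fixes d m \<nu> :: nat
  assumes "m \<ge> 1" and "d \<ge> 2" and "\<nu> \<ge> 1"
  shows "\<exists>C::real. C > 0 \<and>
    (\<forall>(p::nat) (S::nat mat) (F::nat \<Rightarrow> mpoly) (w\<^sub>0::nat \<Rightarrow> int) (\<tau>::nat) (N::nat).
       prime p \<longrightarrow>
       exponent_matrix m S \<longrightarrow>
       (\<Prod>i<m. S $$ (i, i + 1)) \<noteq> 0 \<longrightarrow>
       F \<in> triangular_systems p m S \<longrightarrow>
       system_degree m F = ereal (real d) \<longrightarrow>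
       w\<^sub>0 \<in> {..m} \<rightarrow>\<^sub>E {0..<int p} \<longrightarrow>
       purely_periodic (iterates p m F w\<^sub>0) \<tau> \<longrightarrow>
       1 \<le> N \<longrightarrow> N \<le> \<tau> \<longrightarrow>
       discrepancy m N (\<lambda>n i. real_of_int (iterates p m F w\<^sub>0 n i) / real p)
         \<le> C * (real p powr (real (m\<^sup>2 + m * \<nu> + m) / real (2 * \<nu> * (m + \<nu>)))
                 * real N powr (- (1 / (2 * real \<nu>))) * ln (real p) ^ m))"
proof -
  define C where "C = real m * 2 ^ m + real (\<nu> ^ \<nu> + (2 * m + d) ^ m * 2 ^ (m + \<nu>) + 4 + \<nu>) * 4 ^ m"
  show ?thesis
  proof (intro exI[of _ C] conjI allI impI)
    have "0 < real m * 2 ^ m" using assms by simp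
    moreover have "0 \<le> real (\<nu> ^ \<nu> + (2 * m + d) ^ m * 2 ^ (m + \<nu>) + 4 + \<nu>) * 4 ^ m" by simp
    ultimately show "C > 0" unfolding C_def by linarith
  next
    fix p S F w\<^sub>0 \<tau> N
    assume p: "prime p" and S: "(\<Prod>i<m. S $$ (i, i + 1)) \<noteq> 0" and F: "F \<in> triangular_systems p m S"
      and d: "system_degree m F = ereal (real d)" and w: "w\<^sub>0 \<in> {..m} \<rightarrow>\<^sub>E {0..<int p}"
      and per: "purely_periodic (iterates p m F w\<^sub>0) \<tau>" and N: "1 \<le> N" "N \<le> \<tau>"
    obtain g h l where map: "triangular_map p m (\<lambda>i. S $$ (i, i + 1)) (\<lambda>i. meval (F i)) g h l"
      and le_d: "\<And>i. i < m \<Longrightarrow> S $$ (i, i + 1) \<le> d"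
      by (rule triangular_system_map[OF p S F d]) blast
    interpret triangular_map p m "\<lambda>i. S $$ (i, i + 1)" "\<lambda>i. meval (F i)" g h l
      by (rule map)
    have step: "iterates p m F w\<^sub>0 (Suc n) = T (iterates p m F w\<^sub>0 n)" for n
      by (simp add: T_def)
    have orbit: "iterates p m F w\<^sub>0 n = (T ^^ n) w\<^sub>0" for n
      by (induction n) (simp, simp only: step funpow.simps comp_apply)
    have "inj_on (\<lambda>n. (T ^^ n) w\<^sub>0) {..<N}"
      using inj_on_subset[OF purely_periodic_inj_on[OF per step], of "{..<N}"] N(2)
      unfolding orbit by simp
    thus "discrepancy m N (\<lambda>n i. real_of_int (iterates p m F w\<^sub>0 n i) / real p)
         \<le> C * (real p powr (real (m\<^sup>2 + m * \<nu> + m) / real (2 * \<nu> * (m + \<nu>)))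
                 * real N powr (- (1 / (2 * real \<nu>))) * ln (real p) ^ m)"
      unfolding orbit C_def using assms N(1) w le_d
      by (intro discrepancy_orbit_le) (auto simp: states_def)
  qed
qed

end
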